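(* Let $R \subset \mathbb{Q}$ be a finite set with $|R|\ge 2$ and let $\beta = \beta(R)$. Then for every integer $d \ge 2$, $$\beta(R^d) \le d\,\frac{\left(\frac{\beta}{\beta-1}\right)^d}{\left(\frac{\beta}{\beta-1}\right)^d - 1},$$ where $R^d = R\times\cdots\times R \subset \mathbb{Q}^d$.
   Context: All random variables are discrete and finitely supported; $H$ denotes Shannon entropy. For $d\ge 1$ and a finite set $S \subset \mathbb{Q}^d$ which affinely spans $\mathbb{Q}^d$, $\beta(S)$ is the smallest real number such that for all integer-valued random variables $X, Y_1,\dots,Y_d$ (on a common probability space) $$H(Y_1,\dots,Y_d) \le \beta(S) \max_{(r_1,\dots,r_d)\in S} H(X + r_1Y_1 + \dots + r_dY_d).$$ In particular for $d=1$ and finite $R\subset\mathbb{Q}$ with $|R|\ge 2$, $\beta(R)$ is the smallest $\beta$ with $H(Y)\le \beta\max_{r\in R}H(X+rY)$ for all integer random variables $X,Y$. *)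

theory Defs
  imports "HOL-Probability.Probability"
begin

text \<open>Entropy in bits; the base is immaterial for \<open>beta\<close> below, which only compares entropies.\<close>

definition shannon_entropy :: "'w measure \<Rightarrow> ('w \<Rightarrow> 'b) \<Rightarrow> real" where
  "shannon_entropy M X = prob_space.entropy M 2 (count_space (X ` space M)) X"

text \<open>Points of \<open>\<rat>\<^sup>d\<close> are functions on the indices \<open>{..<d}\<close>, with value \<open>undefined\<close> elsewhere.\<close>

abbreviation cart_power :: "'a set \<Rightarrow> nat \<Rightarrow> (nat \<Rightarrow> 'a) set" where
  "cart_power R d \<equiv> {..<d} \<rightarrow>\<^sub>E R"

text \<open>Finitely supported random variables are the simple functions on a probability space.
  Finitely many of them can always be realized jointly on a sample space of type \<open>nat\<close>, so that
  quantifying over all \<open>M :: nat measure\<close> quantifies over all joint distributions; see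
  \<open>entropy_bound_any_space\<close>.\<close>

definition entropy_bound :: "nat \<Rightarrow> (nat \<Rightarrow> rat) set \<Rightarrow> real \<Rightarrow> bool" where
  "entropy_bound d S b \<longleftrightarrow>
    (\<forall>(M :: nat measure) (X :: nat \<Rightarrow> int) (Y :: nat \<Rightarrow> nat \<Rightarrow> int).
      prob_space M \<longrightarrow> simple_function M X \<longrightarrow> (\<forall>i<d. simple_function M (Y i)) \<longrightarrow>
      shannon_entropy M (\<lambda>\<omega>. \<lambda>i\<in>{..<d}. Y i \<omega>)
        \<le> b * Max ((\<lambda>r. shannon_entropy M (\<lambda>\<omega>. of_int (X \<omega>) + (\<Sum>i<d. r i * of_int (Y i \<omega>)))) ` S))"

lemma shannon_entropy_eq_sum:
  assumes "prob_space M" and X: "simple_function M X"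
    and A: "finite A" "X ` space M \<subseteq> A"
  shows "shannon_entropy M X =
    - (\<Sum>x\<in>A. measure M (X -` {x} \<inter> space M) * log 2 (measure M (X -` {x} \<inter> space M)))"
proof -
  interpret prob_space M by fact
  interpret information_space M 2 by unfold_locales simp
  have "simple_distributed M X (\<lambda>x. measure M (X -` {x} \<inter> space M))"
    by (rule simple_distributedI[OF X]) auto
  from entropy_simple_distributed[OF this] have "shannon_entropy M X =
      - (\<Sum>x\<in>X`space M. measure M (X -` {x} \<inter> space M) * log 2 (measure M (X -` {x} \<inter> space M)))"
    by (simp add: shannon_entropy_def)
  also have "(\<Sum>x\<in>X`space M. measure M (X -` {x} \<inter> space M) * log 2 (measure M (X -` {x} \<inter> space M)))
      = (\<Sum>x\<in>A. measure M (X -` {x} \<inter> space M) * log 2 (measure M (X -` {x} \<inter> space M)))"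
  proof (rule sum.mono_neutral_left[OF A], safe)
    fix x assume "x \<notin> X ` space M"
    then have "X -` {x} \<inter> space M = {}" by auto
    then show "measure M (X -` {x} \<inter> space M) * log 2 (measure M (X -` {x} \<inter> space M)) = 0"
      by simp
  qed
  finally show ?thesis .
qed

lemma shannon_entropy_inj:
  assumes M: "prob_space M" and X: "simple_function M X" and f: "inj_on f (X ` space M)"
  shows "shannon_entropy M (\<lambda>\<omega>. f (X \<omega>)) = shannon_entropy M X"
proof -
  have eq: "(\<lambda>\<omega>. f (X \<omega>)) -` {f x} \<inter> space M = X -` {x} \<inter> space M" if "x \<in> X ` space M" for x
    using that f by (auto simp: inj_on_def)
  have fin: "finite (X ` space M)" using X by (rule simple_functionD)
  have "shannon_entropy M (\<lambda>\<omega>. f (X \<omega>)) = - (\<Sum>x\<in>f ` X ` space M.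
      measure M ((\<lambda>\<omega>. f (X \<omega>)) -` {x} \<inter> space M) * log 2 (measure M ((\<lambda>\<omega>. f (X \<omega>)) -` {x} \<inter> space M)))"
    using fin by (intro shannon_entropy_eq_sum M simple_function_compose1[OF X]) auto
  also have "\<dots> = shannon_entropy M X"
    using fin by (subst sum.reindex[OF f], subst shannon_entropy_eq_sum[OF M X fin])
      (auto simp: eq intro!: sum.cong)
  finally show ?thesis .
qed

lemma shannon_entropy_distr:
  assumes M: "prob_space M" and Z: "Z \<in> M \<rightarrow>\<^sub>M count_space UNIV"
    and X: "finite (range X)"
  shows "shannon_entropy (distr M (count_space UNIV) Z) X = shannon_entropy M (\<lambda>\<omega>. X (Z \<omega>))"
proof -
  let ?N = "distr M (count_space UNIV) Z"
  have N: "prob_space ?N" by (rule prob_space.prob_space_distr[OF M Z])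
  have X1: "simple_function ?N X" using X by (simp add: simple_function_def)
  have X2: "simple_function M (\<lambda>\<omega>. X (Z \<omega>))"
    unfolding simple_function_eq_measurable
  proof
    show "finite ((\<lambda>\<omega>. X (Z \<omega>)) ` space M)" by (rule finite_subset[OF _ X]) auto
    show "(\<lambda>\<omega>. X (Z \<omega>)) \<in> M \<rightarrow>\<^sub>M count_space UNIV"
      by (rule measurable_compose[OF Z]) simp
  qed
  have "measure ?N (X -` {x} \<inter> space ?N) = measure M ((\<lambda>\<omega>. X (Z \<omega>)) -` {x} \<inter> space M)" for x
    by (subst measure_distr[OF Z]) (auto intro!: arg_cong[where f="measure M"])
  then show ?thesis
    by (subst shannon_entropy_eq_sum[OF N X1 X], simp,
        subst shannon_entropy_eq_sum[OF M X2 X]) auto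
qed

theorem entropy_bound_any_space:
  fixes M :: "'w measure" and X :: "'w \<Rightarrow> int" and Y :: "nat \<Rightarrow> 'w \<Rightarrow> int"
  assumes bound: "entropy_bound d S b"
    and M: "prob_space M" and X: "simple_function M X" and Y: "\<And>i. i < d \<Longrightarrow> simple_function M (Y i)"
  shows "shannon_entropy M (\<lambda>\<omega>. \<lambda>i\<in>{..<d}. Y i \<omega>)
    \<le> b * Max ((\<lambda>r. shannon_entropy M (\<lambda>\<omega>. of_int (X \<omega>) + (\<Sum>i<d. r i * of_int (Y i \<omega>)))) ` S)"
proof -
  define V where "V = (\<lambda>\<omega>. (X \<omega>, \<lambda>i\<in>{..<d}. Y i \<omega>))"
  define W where "W = V ` space M"
  have "simple_function M (\<lambda>\<omega>. \<lambda>i\<in>{..<k}. Y i \<omega>)" if "k \<le> d" for k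
    using that
  proof (induction k)
    case 0
    show ?case by simp
  next
    case (Suc k)
    have "(\<lambda>\<omega>. \<lambda>i\<in>{..<Suc k}. Y i \<omega>) = (\<lambda>\<omega>. (\<lambda>i\<in>{..<k}. Y i \<omega>)(k := Y k \<omega>))"
      by (auto simp: fun_eq_iff restrict_def)
    moreover have "simple_function M (\<lambda>\<omega>. (\<lambda>i\<in>{..<k}. Y i \<omega>)(k := Y k \<omega>))"
      by (rule simple_function_compose2[where h="\<lambda>f y. f(k := y)", OF Suc.IH Y]) (use Suc.prems in auto)
    ultimately show ?case by (simp only:)
  qed
  then have V: "simple_function M V" unfolding V_def using X by auto
  have fin: "finite W" unfolding W_def using V by (rule simple_functionD)
  have ne: "W \<noteq> {}" unfolding W_def using prob_space.not_empty[OF M] by simp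
  define e where "e = to_nat_on W"
  define D where "D = from_nat_into W"
  have D: "D n \<in> W" for n unfolding D_def using ne by (rule from_nat_into)
  have De: "D (e (V \<omega>)) = V \<omega>" if "\<omega> \<in> space M" for \<omega>
    unfolding D_def e_def using that fin by (simp add: W_def countable_finite)
  define N where "N = distr M (count_space UNIV) (\<lambda>\<omega>. e (V \<omega>))"
  have Z: "(\<lambda>\<omega>. e (V \<omega>)) \<in> M \<rightarrow>\<^sub>M count_space UNIV"
    using simple_function_compose1[OF V] by (rule measurable_simple_function)
  have N: "prob_space N" unfolding N_def by (rule prob_space.prob_space_distr[OF M Z])
  have finr: "finite (range (\<lambda>n. G (D n)))" for G :: "int \<times> (nat \<Rightarrow> int) \<Rightarrow> 'c"
    by (rule finite_subset[of _ "G ` W"]) (use D fin in auto)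
  have sN: "simple_function N (\<lambda>n. G (D n))" for G :: "int \<times> (nat \<Rightarrow> int) \<Rightarrow> 'c"
    using finr[of G] by (simp add: simple_function_def N_def)
  have cong: "shannon_entropy M F = shannon_entropy M G"
    if "\<And>\<omega>. \<omega> \<in> space M \<Longrightarrow> F \<omega> = G \<omega>" "simple_function M F" for F G :: "'w \<Rightarrow> 'c"
  proof -
    have G: "simple_function M G" using simple_function_cong[of M F G] that by auto
    have im: "F ` space M = G ` space M" using that by auto
    have "F -` {x} \<inter> space M = G -` {x} \<inter> space M" for x using that by auto
    then show ?thesis
      using shannon_entropy_eq_sum[OF M that(2) simple_functionD(1)[OF that(2)]]
        shannon_entropy_eq_sum[OF M G simple_functionD(1)[OF G]] im by simp
  qed
  have tr: "shannon_entropy N (\<lambda>n. G (D n)) = shannon_entropy M (\<lambda>\<omega>. G (V \<omega>))"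
    for G :: "int \<times> (nat \<Rightarrow> int) \<Rightarrow> 'c"
  proof -
    have "shannon_entropy N (\<lambda>n. G (D n)) = shannon_entropy M (\<lambda>\<omega>. G (D (e (V \<omega>))))"
      unfolding N_def by (rule shannon_entropy_distr[OF M Z finr])
    also have "\<dots> = shannon_entropy M (\<lambda>\<omega>. G (V \<omega>))"
      by (rule cong[symmetric]) (auto simp: De simple_function_compose1[OF V])
    finally show ?thesis .
  qed
  have "shannon_entropy N (\<lambda>n. \<lambda>i\<in>{..<d}. snd (D n) i)
      \<le> b * Max ((\<lambda>r. shannon_entropy N (\<lambda>n. of_int (fst (D n)) + (\<Sum>i<d. r i * of_int (snd (D n) i)))) ` S)"
    using bound[unfolded entropy_bound_def, rule_format, OF N, of "\<lambda>n. fst (D n)" "\<lambda>i n. snd (D n) i"]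
      sN[of fst] sN[of "\<lambda>v. snd v _"] by blast
  then show ?thesis
    using tr[of "\<lambda>v. \<lambda>i\<in>{..<d}. snd v i"]
      tr[of "\<lambda>v. of_int (fst v) + (\<Sum>i<d. r i * of_int (snd v i))" for r :: "nat \<Rightarrow> rat"]
    by (simp add: V_def cong: restrict_cong)
qed

text \<open>Meaningful for \<open>d \<ge> 1\<close> and finite \<open>S\<close> affinely spanning \<open>\<rat>\<^sup>d\<close>.\<close>

definition beta :: "nat \<Rightarrow> (nat \<Rightarrow> rat) set \<Rightarrow> real" where
  "beta d S = (LEAST b. entropy_bound d S b)"

lemma beta_1:
  "beta 1 (cart_power R 1) =
    (LEAST b. \<forall>(M :: nat measure) (X :: nat \<Rightarrow> int) (Y :: nat \<Rightarrow> int).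
      prob_space M \<longrightarrow> simple_function M X \<longrightarrow> simple_function M Y \<longrightarrow>
      shannon_entropy M Y
        \<le> b * Max ((\<lambda>r. shannon_entropy M (\<lambda>\<omega>. of_int (X \<omega>) + r * of_int (Y \<omega>))) ` R))"
proof -
  have vec: "shannon_entropy M (\<lambda>\<omega>. \<lambda>i\<in>{..<1}. Y i \<omega>) = shannon_entropy M (Y 0)"
    if "prob_space M" "simple_function M (Y 0)" for M :: "nat measure" and Y :: "nat \<Rightarrow> nat \<Rightarrow> int"
  proof -
    have "(\<lambda>\<omega>. \<lambda>i\<in>{..<1}. Y i \<omega>) = (\<lambda>\<omega>. \<lambda>i\<in>{..<1::nat}. Y 0 \<omega>)"
      by (auto simp: fun_eq_iff restrict_def)
    moreover have "inj_on (\<lambda>y. \<lambda>i\<in>{..<1::nat}. y) A" for A :: "int set"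
      by (auto simp: inj_on_def fun_eq_iff restrict_def)
    ultimately show ?thesis
      using shannon_entropy_inj[OF that, of "\<lambda>y. \<lambda>i\<in>{..<1::nat}. y"] by simp
  qed
  have R: "R = (\<lambda>r. r 0) ` cart_power R 1"
  proof safe
    fix r assume "r \<in> R"
    then show "r \<in> (\<lambda>r. r 0) ` cart_power R 1"
      by (intro image_eqI[of _ _ "\<lambda>i\<in>{..<1}. r"]) auto
  qed auto
  have img: "(\<lambda>r. shannon_entropy M (\<lambda>\<omega>. of_int (X \<omega>) + (\<Sum>i<1. r i * of_int (Y i \<omega>)))) ` cart_power R 1
     = (\<lambda>r. shannon_entropy M (\<lambda>\<omega>. of_int (X \<omega>) + r * of_int (Y 0 \<omega>))) ` R"
    for M :: "nat measure" and X :: "nat \<Rightarrow> int" and Y :: "nat \<Rightarrow> nat \<Rightarrow> int"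
    by (subst (2) R) (simp add: image_image)
  show ?thesis
    unfolding beta_def entropy_bound_def img
  proof (intro arg_cong[where f=Least] ext iffI allI impI)
    fix b and M :: "nat measure" and X Y :: "nat \<Rightarrow> int"
    assume *: "\<forall>(M :: nat measure) (X :: nat \<Rightarrow> int) (Y :: nat \<Rightarrow> nat \<Rightarrow> int). prob_space M \<longrightarrow> simple_function M X \<longrightarrow> (\<forall>i<1. simple_function M (Y i)) \<longrightarrow>
        shannon_entropy M (\<lambda>\<omega>. \<lambda>i\<in>{..<1}. Y i \<omega>)
        \<le> b * Max ((\<lambda>r. shannon_entropy M (\<lambda>\<omega>. of_int (X \<omega>) + r * of_int (Y 0 \<omega>))) ` R)"
      and "prob_space M" "simple_function M X" "simple_function M Y"
    then show "shannon_entropy M Y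
        \<le> b * Max ((\<lambda>r. shannon_entropy M (\<lambda>\<omega>. of_int (X \<omega>) + r * of_int (Y \<omega>))) ` R)"
      using *[rule_format, of M X "\<lambda>_. Y"] vec[of M "\<lambda>_. Y"] by simp
  qed (use vec in auto)
qed

end

theory Submission
  imports Defs "HOL-Computational_Algebra.Polynomial" "HOL-Computational_Algebra.Primes"
begin

text \<open>Independent copies, packed into single integers, show that \<open>H(Y) \<le> \<beta> max H(X + rY)\<close> also holds for
  conditional entropies. Conditioning many copies of \<open>(X, Y)\<close> on random linear hashes of \<open>X\<close> and \<open>Y\<close>
  modulo a prime, each of \<open>H(X|Y)\<close> nats per copy, lowers \<open>H(Y)\<close> and every \<open>H(X + rY)\<close> by \<open>H(X|Y)\<close> and yields
  \<open>H(Y) + (\<beta> - 1) H(X|Y) \<le> \<beta> max H(X + rY)\<close>. With \<open>c = (\<beta> - 1) / \<beta>\<close>, applying this one coordinate at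
  a time, always choosing one with entropy at least the average, gives by induction on \<open>d\<close> that
  \<open>(1 + c + ... + c^(d - 1)) H(Y_1, ..., Y_d) \<le> d \<beta> h\<close> when all \<open>H(X + \<Sum> r_i Y_i) \<le> h\<close>; the sum is \<open>\<beta> (1 - c^d)\<close>.\<close>

section \<open>Entropy under finitely supported distributions\<close>

text \<open>Why both entropies drop: the hash is linear, so X + rY and the hash of Y together
  determine the hash of X, as long as the prime does not divide the denominator of r. Per copy the
  pair of hashes carries about 2 H(X|Y). Joining it to X + rY adds at most the hash of Y, and
  joining it to Y adds only the hash of X, so either way about H(X|Y) is added while 2 H(X|Y) is
  conditioned away. The given inequality for the conditioned variables becomes H(Y) - H(X|Y) <= b (h
  - H(X|Y)), which rearranges to the gain. H(X|Y) is the highest rate at which a hash of X can stay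
  nearly uniform given Y. The gain is what the induction lives on. With X replaced by X plus the
  terms of the other coordinates, it bounds the entropy of that sum given Y_i by (b h - H(Y_i)) / (b
  - 1): a large H(Y_i) leaves a small bound for the remaining coordinates. The obstacle is that
  hashing couples the copies and leaves conditional laws that are not products. Hence the inequality
  must first be available for arbitrary conditional entropies and for lists of pairs.\<close>

definition ent :: "'a pmf \<Rightarrow> ('a \<Rightarrow> 'b) \<Rightarrow> real" where
  "ent p f = (\<Sum>\<omega>\<in>set_pmf p. pmf p \<omega> * - ln (pmf (map_pmf f p) (f \<omega>)))"

definition cent :: "'a pmf \<Rightarrow> ('a \<Rightarrow> 'b) \<Rightarrow> ('a \<Rightarrow> 'c) \<Rightarrow> real" where
  "cent p f w = ent p (\<lambda>\<omega>. (f \<omega>, w \<omega>)) - ent p w"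

lemma pmf_map_eq_sum:
  assumes "finite (set_pmf p)"
  shows "pmf (map_pmf f p) v = (\<Sum>\<omega> | \<omega> \<in> set_pmf p \<and> f \<omega> = v. pmf p \<omega>)"
proof -
  have "pmf (map_pmf f p) v = measure (measure_pmf p) (f -` {v} \<inter> set_pmf p)"
    by (simp add: pmf_map measure_Int_set_pmf)
  also have "f -` {v} \<inter> set_pmf p = {\<omega> \<in> set_pmf p. f \<omega> = v}" by auto
  finally show ?thesis using assms by (simp add: measure_measure_pmf_finite)
qed

text \<open>Links the two ways of taking a mean. \<open>ent\<close> averages the surprisal over
  sample points, so that the entropies of several functions compare term by term; sums over values
  are used where probabilities have to be added up.\<close>

lemma sum_pmf_comp:
  fixes F :: "'b \<Rightarrow> real"
  assumes "finite (set_pmf p)"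
  shows "(\<Sum>\<omega>\<in>set_pmf p. pmf p \<omega> * F (f \<omega>)) = (\<Sum>v\<in>f ` set_pmf p. pmf (map_pmf f p) v * F v)"
proof -
  have "(\<Sum>\<omega>\<in>set_pmf p. pmf p \<omega> * F (f \<omega>))
      = (\<Sum>v\<in>f ` set_pmf p. \<Sum>\<omega> | \<omega> \<in> set_pmf p \<and> f \<omega> = v. pmf p \<omega> * F (f \<omega>))"
    using assms by (rule sum.image_gen)
  also have "\<dots> = (\<Sum>v\<in>f ` set_pmf p. pmf (map_pmf f p) v * F v)"
    by (simp add: pmf_map_eq_sum[OF assms] sum_distrib_right)
  finally show ?thesis .
qed

lemma pmf_map_pos: "\<omega> \<in> set_pmf p \<Longrightarrow> 0 < pmf (map_pmf f p) (f \<omega>)"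
  by (simp add: pmf_positive)

lemma pmf_map_mono:
  assumes "finite (set_pmf p)" "\<omega> \<in> set_pmf p"
    and "\<And>\<omega>'. \<omega>' \<in> set_pmf p \<Longrightarrow> f \<omega>' = f \<omega> \<Longrightarrow> g \<omega>' = g \<omega>"
  shows "pmf (map_pmf f p) (f \<omega>) \<le> pmf (map_pmf g p) (g \<omega>)"
  unfolding pmf_map_eq_sum[OF assms(1)] 
proof (rule sum_mono2)
  show "{\<omega>' \<in> set_pmf p. f \<omega>' = f \<omega>} \<subseteq> {\<omega>' \<in> set_pmf p. g \<omega>' = g \<omega>}"
    using assms(3) by blast
qed (simp_all add: assms(1))

lemma ent_mono:
  assumes "finite (set_pmf p)"
    and "\<And>\<omega> \<omega>'. \<omega> \<in> set_pmf p \<Longrightarrow> \<omega>' \<in> set_pmf p \<Longrightarrow> f \<omega> = f \<omega>' \<Longrightarrow> g \<omega> = g \<omega>'"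
  shows "ent p g \<le> ent p f"
  unfolding ent_def
proof (intro sum_mono mult_left_mono)
  fix \<omega> assume \<omega>: "\<omega> \<in> set_pmf p"
  have "pmf (map_pmf f p) (f \<omega>) \<le> pmf (map_pmf g p) (g \<omega>)"
    using assms(2) by (intro pmf_map_mono[OF assms(1) \<omega>]) (use \<omega> in blast)
  then show "- ln (pmf (map_pmf g p) (g \<omega>)) \<le> - ln (pmf (map_pmf f p) (f \<omega>))"
    using pmf_map_pos[OF \<omega>, of f] by simp
qed simp

lemma ent_eqI:
  assumes "finite (set_pmf p)"
    and "\<And>\<omega> \<omega>'. \<omega> \<in> set_pmf p \<Longrightarrow> \<omega>' \<in> set_pmf p \<Longrightarrow> f \<omega> = f \<omega>' \<longleftrightarrow> g \<omega> = g \<omega>'"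
  shows "ent p f = ent p g"
  by (intro antisym ent_mono assms(1)) (use assms(2) in blast)+

lemma ent_nonneg: "0 \<le> ent p f"
  unfolding ent_def
proof (intro sum_nonneg mult_nonneg_nonneg)
  fix \<omega> assume "\<omega> \<in> set_pmf p"
  then have "ln (pmf (map_pmf f p) (f \<omega>)) \<le> ln 1"
    by (subst ln_le_cancel_iff) (auto simp: pmf_map_pos pmf_le_1)
  then show "0 \<le> - ln (pmf (map_pmf f p) (f \<omega>))" by simp
qed simp

lemma ent_const [simp]: "ent p (\<lambda>_. c) = 0"
  by (simp add: ent_def map_pmf_const)

lemma sum_pmf_fst:
  assumes "finite (set_pmf p)"
  shows "(\<Sum>a\<in>f ` set_pmf p. pmf (map_pmf (\<lambda>\<omega>. (f \<omega>, w \<omega>)) p) (a, c)) = pmf (map_pmf w p) c"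
proof -
  have "pmf (map_pmf w p) c = (\<Sum>\<omega> | \<omega> \<in> set_pmf p \<and> w \<omega> = c. pmf p \<omega>)"
    by (rule pmf_map_eq_sum[OF assms])
  also have "\<dots> = (\<Sum>a\<in>f ` set_pmf p. \<Sum>\<omega> | \<omega> \<in> {\<omega> \<in> set_pmf p. w \<omega> = c} \<and> f \<omega> = a. pmf p \<omega>)"
    using assms by (intro sum.group[symmetric]) auto
  also have "\<dots> = (\<Sum>a\<in>f ` set_pmf p. pmf (map_pmf (\<lambda>\<omega>. (f \<omega>, w \<omega>)) p) (a, c))"
    unfolding pmf_map_eq_sum[OF assms] by (intro sum.cong) auto
  finally show ?thesis by simp
qed

text \<open>Nonnegativity of conditional mutual information. The difference of the two sides is the
  mean of ln D, where D compares the conditionally independent law with the true one; ln D <= D - 1,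
  and D has mean at most 1.\<close>

lemma ent_submodular:
  assumes fin: "finite (set_pmf p)"
  shows "ent p (\<lambda>\<omega>. (f \<omega>, g \<omega>, w \<omega>)) + ent p w
    \<le> ent p (\<lambda>\<omega>. (f \<omega>, w \<omega>)) + ent p (\<lambda>\<omega>. (g \<omega>, w \<omega>))"
proof -
  define S where "S = set_pmf p"
  define A where "A = (\<lambda>a c. pmf (map_pmf (\<lambda>\<omega>. (f \<omega>, w \<omega>)) p) (a, c))"
  define B where "B = (\<lambda>b c. pmf (map_pmf (\<lambda>\<omega>. (g \<omega>, w \<omega>)) p) (b, c))"
  define J where "J = (\<lambda>v. pmf (map_pmf (\<lambda>\<omega>. (f \<omega>, g \<omega>, w \<omega>)) p) v)"
  define C where "C = (\<lambda>c. pmf (map_pmf w p) c)"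
  define D where "D = (\<lambda>v. case v of (a, b, c) \<Rightarrow> A a c * B b c / (J v * C c))"
  note defs = S_def A_def B_def J_def C_def D_def
  have pos: "0 < A (f \<omega>) (w \<omega>)" "0 < B (g \<omega>) (w \<omega>)" "0 < J (f \<omega>, g \<omega>, w \<omega>)" "0 < C (w \<omega>)"
    if "\<omega> \<in> S" for \<omega>
    using that pmf_map_pos[of \<omega> p "\<lambda>\<omega>. (f \<omega>, w \<omega>)"] pmf_map_pos[of \<omega> p "\<lambda>\<omega>. (g \<omega>, w \<omega>)"]
      pmf_map_pos[of \<omega> p "\<lambda>\<omega>. (f \<omega>, g \<omega>, w \<omega>)"] pmf_map_pos[of \<omega> p w]
    by (auto simp: defs)
  have finS: "finite S" using fin by (simp add: S_def)
  have "(\<Sum>\<omega>\<in>S. pmf p \<omega> * D (f \<omega>, g \<omega>, w \<omega>))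
      = (\<Sum>v\<in>(\<lambda>\<omega>. (f \<omega>, g \<omega>, w \<omega>)) ` S. J v * D v)"
    unfolding S_def J_def by (rule sum_pmf_comp[OF fin])
  also have "\<dots> = (\<Sum>v\<in>(\<lambda>\<omega>. (f \<omega>, g \<omega>, w \<omega>)) ` S. case v of (a, b, c) \<Rightarrow> A a c * B b c / C c)"
  proof (rule sum.cong[OF refl])
    fix v assume "v \<in> (\<lambda>\<omega>. (f \<omega>, g \<omega>, w \<omega>)) ` S"
    then obtain \<omega> where "\<omega> \<in> S" "v = (f \<omega>, g \<omega>, w \<omega>)" by auto
    then show "J v * D v = (case v of (a, b, c) \<Rightarrow> A a c * B b c / C c)"
      using pos[of \<omega>] by (simp add: D_def)
  qed
  \<comment> \<open>Triples outside the support only add nonnegative terms, and over the full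
    product the sum factors.\<close>
  also have "\<dots> \<le> (\<Sum>v\<in>f ` S \<times> g ` S \<times> w ` S. case v of (a, b, c) \<Rightarrow> A a c * B b c / C c)"
    using finS by (intro sum_mono2) (auto simp: A_def B_def C_def)
  also have "\<dots> = (\<Sum>a\<in>f ` S. \<Sum>b\<in>g ` S. \<Sum>c\<in>w ` S. A a c * B b c / C c)"
    by (simp add: sum.cartesian_product)
  also have "\<dots> = (\<Sum>a\<in>f ` S. \<Sum>c\<in>w ` S. \<Sum>b\<in>g ` S. A a c * B b c / C c)"
    by (intro sum.cong refl sum.swap)
  also have "\<dots> = (\<Sum>c\<in>w ` S. \<Sum>a\<in>f ` S. \<Sum>b\<in>g ` S. A a c * B b c / C c)"
    by (rule sum.swap)
  also have "\<dots> = (\<Sum>c\<in>w ` S. (\<Sum>a\<in>f ` S. A a c) * (\<Sum>b\<in>g ` S. B b c) / C c)"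
    by (simp add: sum_product sum_divide_distrib)
  also have "\<dots> = (\<Sum>c\<in>w ` S. C c * C c / C c)"
    unfolding A_def B_def C_def S_def by (simp add: sum_pmf_fst[OF fin])
  also have "\<dots> = (\<Sum>c\<in>w ` S. C c * 1)"
    by (intro sum.cong) auto
  also have "\<dots> = (\<Sum>\<omega>\<in>S. pmf p \<omega> * 1)"
    unfolding C_def S_def by (rule sum_pmf_comp[OF fin, symmetric])
  also have "\<dots> = 1" using finS by (simp add: S_def sum_pmf_eq_1)
  finally have le: "(\<Sum>\<omega>\<in>S. pmf p \<omega> * D (f \<omega>, g \<omega>, w \<omega>)) \<le> 1" .
  have "ent p (\<lambda>\<omega>. (f \<omega>, g \<omega>, w \<omega>)) + ent p w
      - (ent p (\<lambda>\<omega>. (f \<omega>, w \<omega>)) + ent p (\<lambda>\<omega>. (g \<omega>, w \<omega>)))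
    = (\<Sum>\<omega>\<in>S. pmf p \<omega> * (- ln (J (f \<omega>, g \<omega>, w \<omega>)) - ln (C (w \<omega>)) + ln (A (f \<omega>) (w \<omega>)) + ln (B (g \<omega>) (w \<omega>))))"
    unfolding ent_def A_def B_def J_def C_def S_def
    by (simp add: sum.distrib sum_subtractf sum_negf algebra_simps)
  also have "\<dots> = (\<Sum>\<omega>\<in>S. pmf p \<omega> * ln (D (f \<omega>, g \<omega>, w \<omega>)))"
  proof (rule sum.cong[OF refl])
    fix \<omega> assume "\<omega> \<in> S"
    note p = pos[OF this]
    show "pmf p \<omega> * (- ln (J (f \<omega>, g \<omega>, w \<omega>)) - ln (C (w \<omega>)) + ln (A (f \<omega>) (w \<omega>)) + ln (B (g \<omega>) (w \<omega>)))
        = pmf p \<omega> * ln (D (f \<omega>, g \<omega>, w \<omega>))"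
      using p[THEN less_imp_neq, symmetric] p by (simp add: D_def ln_mult ln_div)
  qed
  also have "\<dots> \<le> (\<Sum>\<omega>\<in>S. pmf p \<omega> * (D (f \<omega>, g \<omega>, w \<omega>) - 1))"
    using pos by (intro sum_mono mult_left_mono ln_le_minus_one) (auto simp: D_def)
  also have "\<dots> \<le> 0"
    using le finS by (simp add: algebra_simps sum_subtractf S_def sum_pmf_eq_1)
  finally show ?thesis by simp
qed

text \<open>Again ln x <= x - 1, now applied to the ratio of the uniform law on B to the law of
  f.\<close>

lemma ent_le_ln_card:
  assumes fin: "finite (set_pmf p)" and "finite B" "f ` set_pmf p \<subseteq> B"
  shows "ent p f \<le> ln (card B)"
proof -
  have ne: "f ` set_pmf p \<noteq> {}" by (simp add: set_pmf_not_empty)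
  then have card: "0 < card B" using assms by (metis card_gt_0_iff subset_empty)
  have "ent p f - ln (card B) = (\<Sum>\<omega>\<in>set_pmf p. pmf p \<omega> * (- ln (pmf (map_pmf f p) (f \<omega>)) - ln (card B)))"
    using fin by (simp add: ent_def right_diff_distrib sum_subtractf sum_negf sum_pmf_eq_1
        flip: sum_distrib_right)
  also have "\<dots> = (\<Sum>\<omega>\<in>set_pmf p. pmf p \<omega> * ln (1 / (pmf (map_pmf f p) (f \<omega>) * card B)))"
  proof (rule sum.cong[OF refl])
    fix \<omega> assume "\<omega> \<in> set_pmf p"
    note p = pmf_map_pos[OF this, of f]
    show "pmf p \<omega> * (- ln (pmf (map_pmf f p) (f \<omega>)) - ln (card B))
        = pmf p \<omega> * ln (1 / (pmf (map_pmf f p) (f \<omega>) * card B))"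
      using p[THEN less_imp_neq, symmetric] p card by (simp add: ln_div ln_mult)
  qed
  also have "\<dots> \<le> (\<Sum>\<omega>\<in>set_pmf p. pmf p \<omega> * (1 / (pmf (map_pmf f p) (f \<omega>) * card B) - 1))"
    using card by (intro sum_mono mult_left_mono ln_le_minus_one) (auto simp: pmf_map_pos)
  also have "\<dots> = (\<Sum>v\<in>f ` set_pmf p. pmf (map_pmf f p) v * (1 / (pmf (map_pmf f p) v * card B) - 1))"
    by (rule sum_pmf_comp[OF fin])
  also have "\<dots> = (\<Sum>v\<in>f ` set_pmf p. 1 / card B - pmf (map_pmf f p) v)"
  proof (rule sum.cong[OF refl])
    fix v assume "v \<in> f ` set_pmf p"
    then have "pmf (map_pmf f p) v > 0" using pmf_map_pos by fast
    then show "pmf (map_pmf f p) v * (1 / (pmf (map_pmf f p) v * card B) - 1) = 1 / card B - pmf (map_pmf f p) v"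
      using card by (simp add: field_simps)
  qed
  also have "\<dots> = card (f ` set_pmf p) / card B - 1"
    using fin by (simp add: sum_subtractf sum_pmf_eq_1)
  also have "\<dots> \<le> 0"
    using card card_mono[OF assms(2,3)] by simp
  finally show ?thesis by simp
qed

section \<open>Conditional entropy\<close>

lemma cent_nonneg: "finite (set_pmf p) \<Longrightarrow> 0 \<le> cent p f w"
  unfolding cent_def using ent_mono[of p "\<lambda>\<omega>. (f \<omega>, w \<omega>)" w] by auto

lemma cent_eqI:
  assumes "finite (set_pmf p)"
    and "\<And>\<omega> \<omega>'. \<omega> \<in> set_pmf p \<Longrightarrow> \<omega>' \<in> set_pmf p \<Longrightarrow> w \<omega> = w \<omega>' \<Longrightarrow> f \<omega> = f \<omega>' \<longleftrightarrow> g \<omega> = g \<omega>'"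
  shows "cent p f w = cent p g w"
  unfolding cent_def
  by (intro arg_cong2[where f="(-)"] ent_eqI assms(1) refl) (use assms(2) in blast)

lemma cent_mono:
  assumes "finite (set_pmf p)"
    and "\<And>\<omega> \<omega>'. \<omega> \<in> set_pmf p \<Longrightarrow> \<omega>' \<in> set_pmf p \<Longrightarrow> w \<omega> = w \<omega>' \<Longrightarrow> f \<omega> = f \<omega>' \<Longrightarrow> g \<omega> = g \<omega>'"
  shows "cent p g w \<le> cent p f w"
  unfolding cent_def
  by (intro diff_right_mono ent_mono assms(1)) (use assms(2) in blast)

lemma cent_chain: "finite (set_pmf p) \<Longrightarrow>
  cent p (\<lambda>\<omega>. (f \<omega>, g \<omega>)) w = cent p g w + cent p f (\<lambda>\<omega>. (g \<omega>, w \<omega>))"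
  unfolding cent_def
  using ent_eqI[of p "\<lambda>\<omega>. ((f \<omega>, g \<omega>), w \<omega>)" "\<lambda>\<omega>. (f \<omega>, g \<omega>, w \<omega>)"] by auto

lemma cent_pair_le: "finite (set_pmf p) \<Longrightarrow> cent p f (\<lambda>\<omega>. (g \<omega>, w \<omega>)) \<le> cent p f w"
  using ent_submodular[of p f g w] by (simp add: cent_def)

lemma cent_antimono:
  assumes fin: "finite (set_pmf p)"
    and "\<And>\<omega> \<omega>'. \<omega> \<in> set_pmf p \<Longrightarrow> \<omega>' \<in> set_pmf p \<Longrightarrow> v \<omega> = v \<omega>' \<Longrightarrow> w \<omega> = w \<omega>'"
  shows "cent p f v \<le> cent p f w"
proof -
  have "cent p f v = cent p f (\<lambda>\<omega>. (v \<omega>, w \<omega>))"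
    unfolding cent_def
    by (intro arg_cong2[where f="(-)"] ent_eqI fin) (use assms(2) in blast)+
  also have "\<dots> \<le> cent p f w" by (rule cent_pair_le[OF fin])
  finally show ?thesis .
qed

lemma cent_restrict_le_sum:
  assumes fin: "finite (set_pmf p)" and "finite I"
  shows "cent p (\<lambda>\<omega>. \<lambda>i\<in>I. Y i \<omega>) w \<le> (\<Sum>i\<in>I. cent p (Y i) w)"
  using \<open>finite I\<close>
proof induction
  case empty
  have "ent p (\<lambda>\<omega>. (\<lambda>i\<in>{}. Y i \<omega>, w \<omega>)) = ent p w"
    by (rule ent_eqI[OF fin]) auto
  then show ?case unfolding cent_def sum.empty by linarith
next
  case (insert j I)
  have "cent p (\<lambda>\<omega>. \<lambda>i\<in>insert j I. Y i \<omega>) w \<le> cent p (\<lambda>\<omega>. (Y j \<omega>, \<lambda>i\<in>I. Y i \<omega>)) w"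
    by (rule cent_mono[OF fin]) (auto simp: fun_eq_iff restrict_def split: if_splits)
  also have "\<dots> \<le> cent p (\<lambda>\<omega>. \<lambda>i\<in>I. Y i \<omega>) w + cent p (Y j) w"
    using cent_pair_le[OF fin] by (simp add: cent_chain[OF fin])
  finally show ?case unfolding sum.insert[OF insert.hyps] using insert.IH by linarith
qed

section \<open>Conditioning and independent products\<close>

lemma cent_eq_sum:
  "cent p f w = (\<Sum>\<omega>\<in>set_pmf p. pmf p \<omega> *
    - ln (pmf (map_pmf (\<lambda>\<omega>. (f \<omega>, w \<omega>)) p) (f \<omega>, w \<omega>) / pmf (map_pmf w p) (w \<omega>)))"
proof -
  have "ln (pmf (map_pmf (\<lambda>\<omega>. (f \<omega>, w \<omega>)) p) (f \<omega>, w \<omega>) / pmf (map_pmf w p) (w \<omega>))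
      = ln (pmf (map_pmf (\<lambda>\<omega>. (f \<omega>, w \<omega>)) p) (f \<omega>, w \<omega>)) - ln (pmf (map_pmf w p) (w \<omega>))"
    if "\<omega> \<in> set_pmf p" for \<omega>
    using pmf_map_pos[OF that, of "\<lambda>\<omega>. (f \<omega>, w \<omega>)"] pmf_map_pos[OF that, of w] by (simp add: ln_div)
  then show ?thesis
    by (simp add: cent_def ent_def right_diff_distrib sum_subtractf sum_negf cong: sum.cong)
qed

text \<open>Turns a conditional entropy into a weighted sum of entropies of genuine distributions,
  to which an unconditional inequality can be applied.\<close>

lemma cent_eq_sum_cond_pmf:
  assumes fin: "finite (set_pmf p)"
  shows "cent p f w = (\<Sum>c\<in>w ` set_pmf p. pmf (map_pmf w p) c * ent (cond_pmf p {\<omega>. w \<omega> = c}) f)"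
proof -
  define G where "G = (\<lambda>\<omega>. - ln (pmf (map_pmf (\<lambda>\<omega>. (f \<omega>, w \<omega>)) p) (f \<omega>, w \<omega>) / pmf (map_pmf w p) (w \<omega>)))"
  have "pmf (map_pmf w p) c * ent (cond_pmf p {\<omega>. w \<omega> = c}) f
      = (\<Sum>\<omega> | \<omega> \<in> set_pmf p \<and> w \<omega> = c. pmf p \<omega> * G \<omega>)" if c: "c \<in> w ` set_pmf p" for c
  proof -
    define q where "q = cond_pmf p {\<omega>. w \<omega> = c}"
    define P where "P = pmf (map_pmf w p) c"
    have ne: "set_pmf p \<inter> {\<omega>. w \<omega> = c} \<noteq> {}" using c by auto
    have P: "P > 0" using c by (auto simp: P_def intro!: pmf_map_pos)
    have "measure (measure_pmf p) {\<omega>. w \<omega> = c} = P"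
      by (auto simp: P_def pmf_map vimage_def)
    then have q: "pmf q \<omega> = (if w \<omega> = c then pmf p \<omega> / P else 0)" for \<omega>
      by (simp add: q_def pmf_cond[OF ne])
    have sq: "set_pmf q = {\<omega> \<in> set_pmf p. w \<omega> = c}"
      by (auto simp: q_def set_cond_pmf[OF ne])
    have finq: "finite (set_pmf q)" using fin by (simp add: sq)
    have *: "pmf (map_pmf f q) (f \<omega>) = pmf (map_pmf (\<lambda>\<omega>. (f \<omega>, w \<omega>)) p) (f \<omega>, w \<omega>) / P"
      if "w \<omega> = c" for \<omega>
      unfolding pmf_map_eq_sum[OF finq] pmf_map_eq_sum[OF fin] sum_divide_distrib
      by (rule sum.cong) (use that in \<open>auto simp: sq q\<close>)
    have "P * ent q f = (\<Sum>\<omega> | \<omega> \<in> set_pmf p \<and> w \<omega> = c. P * (pmf q \<omega> * - ln (pmf (map_pmf f q) (f \<omega>))))"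
      unfolding ent_def sq sum_distrib_left by simp
    also have "\<dots> = (\<Sum>\<omega> | \<omega> \<in> set_pmf p \<and> w \<omega> = c. pmf p \<omega> * G \<omega>)"
      by (rule sum.cong) (use P in \<open>auto simp: q * G_def P_def\<close>)
    finally show ?thesis by (simp add: P_def q_def)
  qed
  then have "(\<Sum>c\<in>w ` set_pmf p. pmf (map_pmf w p) c * ent (cond_pmf p {\<omega>. w \<omega> = c}) f)
     = (\<Sum>c\<in>w ` set_pmf p. \<Sum>\<omega> | \<omega> \<in> set_pmf p \<and> w \<omega> = c. pmf p \<omega> * G \<omega>)"
    by (rule sum.cong[OF refl])
  also have "\<dots> = (\<Sum>\<omega>\<in>set_pmf p. pmf p \<omega> * G \<omega>)"
    using fin by (rule sum.image_gen[symmetric])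
  finally show ?thesis by (simp add: cent_eq_sum G_def)
qed

lemma ent_map_pmf:
  assumes "finite (set_pmf p)"
  shows "ent (map_pmf h p) f = ent p (\<lambda>x. f (h x))"
  unfolding ent_def set_map_pmf map_pmf_comp by (rule sum_pmf_comp[OF assms, symmetric])

lemma pmf_pair_fst_snd: "pmf (pair_pmf p q) z = pmf p (fst z) * pmf q (snd z)"
  by (cases z) (simp add: pmf_pair)

lemma ent_pair_pmf:
  assumes fin: "finite (set_pmf p)" "finite (set_pmf q)"
  shows "ent (pair_pmf p q) (\<lambda>(x, y). (f x, g y)) = ent p f + ent q g"
proof -
  define P where "P = (\<lambda>x. pmf (map_pmf f p) (f x))"
  define Q where "Q = (\<lambda>x. pmf (map_pmf g q) (g x))"
  have "ent (pair_pmf p q) (\<lambda>(x, y). (f x, g y))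
      = (\<Sum>x\<in>set_pmf p. \<Sum>y\<in>set_pmf q. pmf p x * pmf q y * - ln (P x * Q y))"
    by (simp add: ent_def map_pair[unfolded split_def] pmf_pair_fst_snd P_def Q_def sum.cartesian_product split_def)
  also have "\<dots> = (\<Sum>x\<in>set_pmf p. pmf p x * - ln (P x)) * (\<Sum>y\<in>set_pmf q. pmf q y)
      + (\<Sum>x\<in>set_pmf p. pmf p x) * (\<Sum>y\<in>set_pmf q. pmf q y * - ln (Q y))"
    unfolding sum_product sum.distrib[symmetric]
  proof (intro sum.cong refl)
    fix x y assume "x \<in> set_pmf p" "y \<in> set_pmf q"
    then have "P x > 0" "Q y > 0" by (auto simp: P_def Q_def intro!: pmf_map_pos)
    then show "pmf p x * pmf q y * - ln (P x * Q y) =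
       pmf p x * - ln (P x) * pmf q y + pmf p x * (pmf q y * - ln (Q y))"
      by (simp add: ln_mult algebra_simps)
  qed
  also have "\<dots> = (\<Sum>x\<in>set_pmf p. pmf p x * - ln (P x)) + (\<Sum>y\<in>set_pmf q. pmf q y * - ln (Q y))"
    using fin by (simp add: sum_pmf_eq_1)
  finally show ?thesis by (simp add: ent_def P_def Q_def)
qed

text \<open>Independent draws from possibly different distributions: independent copies are the case
  of \<open>replicate\<close>, while the passage to conditional entropies mixes several conditional
  laws in one list.\<close>

primrec list_pmf :: "'a pmf list \<Rightarrow> 'a list pmf" where
  "list_pmf [] = return_pmf []"
| "list_pmf (q # qs) = map_pmf (\<lambda>(x, xs). x # xs) (pair_pmf q (list_pmf qs))"

lemma inj_Cons: "inj (\<lambda>(x, xs). x # xs)"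
  by (auto simp: inj_def)

lemma pmf_list_pmf_Cons [simp]: "pmf (list_pmf (q # qs)) (x # xs) = pmf q x * pmf (list_pmf qs) xs"
  using pmf_map_inj'[OF inj_Cons, of "pair_pmf q (list_pmf qs)" "(x, xs)"] by (simp add: pmf_pair)

lemma finite_set_list_pmf: "\<forall>q\<in>set qs. finite (set_pmf q) \<Longrightarrow> finite (set_pmf (list_pmf qs))"
  by (induction qs) auto

lemma length_list_pmf: "xs \<in> set_pmf (list_pmf qs) \<Longrightarrow> length xs = length qs"
  by (induction qs arbitrary: xs) auto

lemma set_list_pmf_replicate: "xs \<in> set_pmf (list_pmf (replicate n q)) \<Longrightarrow> set xs \<subseteq> set_pmf q"
  by (induction n arbitrary: xs) fastforce+

lemma map_list_pmf: "map_pmf (map f) (list_pmf qs) = list_pmf (map (map_pmf f) qs)"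
proof (induction qs)
  case (Cons q qs)
  have "map_pmf (map f) (list_pmf (q # qs))
      = map_pmf (\<lambda>(x, xs). x # xs) (map_pmf (\<lambda>(x, xs). (f x, map f xs)) (pair_pmf q (list_pmf qs)))"
    by (simp add: map_pmf_comp split_def)
  then show ?case by (simp add: map_pair Cons.IH)
qed simp

lemma pmf_map_list_pmf_replicate:
  assumes "xs \<in> set_pmf (list_pmf (replicate n q))"
  shows "pmf (map_pmf (map f) (list_pmf (replicate n q))) (map f xs) = (\<Prod>x\<leftarrow>xs. pmf (map_pmf f q) (f x))"
  using assms
proof (induction n arbitrary: xs)
  case (Suc n)
  then obtain y ys where "xs = y # ys" "ys \<in> set_pmf (list_pmf (replicate n q))" by auto
  then show ?case
    using Suc.IH[of ys] by (simp add: map_list_pmf del: list_pmf.simps)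
qed simp

lemma ent_list_pmf:
  assumes "\<forall>q\<in>set qs. finite (set_pmf q)"
  shows "ent (list_pmf qs) (map f) = (\<Sum>q\<leftarrow>qs. ent q f)"
  using assms
proof (induction qs)
  case Nil
  show ?case by (simp add: ent_def)
next
  case (Cons q qs)
  have fin: "finite (set_pmf q)" "finite (set_pmf (list_pmf qs))"
    using Cons.prems by (auto intro: finite_set_list_pmf)
  then have fin2: "finite (set_pmf (pair_pmf q (list_pmf qs)))" by simp
  have "ent (list_pmf (q # qs)) (map f) = ent (pair_pmf q (list_pmf qs)) (\<lambda>(x, xs). f x # map f xs)"
    by (simp add: ent_map_pmf[OF fin2] split_def)
  also have "\<dots> = ent (pair_pmf q (list_pmf qs)) (\<lambda>(x, xs). (f x, map f xs))"
    by (rule ent_eqI[OF fin2]) auto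
  finally show ?case using Cons by (simp add: ent_pair_pmf[OF fin])
qed

section \<open>Moments of sums of independent samples\<close>

lemma sum_list_pmf_Cons:
  fixes F :: "'a list \<Rightarrow> real"
  assumes "finite (set_pmf q)" "finite (set_pmf (list_pmf qs))"
  shows "(\<Sum>\<omega>\<in>set_pmf (list_pmf (q # qs)). pmf (list_pmf (q # qs)) \<omega> * F \<omega>)
    = (\<Sum>x\<in>set_pmf q. \<Sum>xs\<in>set_pmf (list_pmf qs). pmf q x * pmf (list_pmf qs) xs * F (x # xs))"
proof -
  have "(\<Sum>\<omega>\<in>set_pmf (list_pmf (q # qs)). pmf (list_pmf (q # qs)) \<omega> * F \<omega>)
    = (\<Sum>v\<in>set_pmf (pair_pmf q (list_pmf qs)). pmf (pair_pmf q (list_pmf qs)) v * F (case v of (x, xs) \<Rightarrow> x # xs))"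
    using assms by (simp only: list_pmf.simps set_map_pmf) (intro sum_pmf_comp[symmetric], simp)
  then show ?thesis by (simp add: sum.cartesian_product pmf_pair_fst_snd split_def del: list_pmf.simps)
qed

text \<open>The variance of a sum of independent centred terms is additive, since the cross term
  contains the mean of J as a factor. This is all the concentration that the hashing argument
  uses.\<close>

lemma
  fixes J :: "'a \<Rightarrow> real"
  assumes fin: "finite (set_pmf q)" and J: "(\<Sum>x\<in>set_pmf q. pmf q x * J x) = 0"
  shows first_moment_list_pmf:
      "(\<Sum>xs\<in>set_pmf (list_pmf (replicate n q)). pmf (list_pmf (replicate n q)) xs * (\<Sum>x\<leftarrow>xs. J x)) = 0"
    and second_moment_list_pmf:
      "(\<Sum>xs\<in>set_pmf (list_pmf (replicate n q)). pmf (list_pmf (replicate n q)) xs * (\<Sum>x\<leftarrow>xs. J x)\<^sup>2)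
        = n * (\<Sum>x\<in>set_pmf q. pmf q x * (J x)\<^sup>2)"
proof (induction n)
  case 0
  { case 1 show ?case by simp }
  { case 2 show ?case by simp }
next
  case (Suc n)
  define P where "P = list_pmf (replicate n q)"
  have finP: "finite (set_pmf P)" using fin by (simp add: P_def finite_set_list_pmf)
  have IH1: "(\<Sum>xs\<in>set_pmf P. pmf P xs * (\<Sum>x\<leftarrow>xs. J x)) = 0"
    and IH2: "(\<Sum>xs\<in>set_pmf P. pmf P xs * (\<Sum>x\<leftarrow>xs. J x)\<^sup>2) = n * (\<Sum>x\<in>set_pmf q. pmf q x * (J x)\<^sup>2)"
    using Suc by (simp_all add: P_def)
  have one: "(\<Sum>xs\<in>set_pmf P. pmf P xs) = 1" "(\<Sum>x\<in>set_pmf q. pmf q x) = 1"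
    using fin finP by (simp_all add: sum_pmf_eq_1)
  note S = sum_list_pmf_Cons[OF fin finP[unfolded P_def], folded P_def]
  let ?T = "\<lambda>xs. \<Sum>x\<leftarrow>xs. J x"
  { case 1
    have "(\<Sum>x\<in>set_pmf q. \<Sum>xs\<in>set_pmf P. pmf q x * pmf P xs * ?T (x # xs))
      = (\<Sum>x\<in>set_pmf q. pmf q x * J x) * (\<Sum>xs\<in>set_pmf P. pmf P xs)
      + (\<Sum>x\<in>set_pmf q. pmf q x) * (\<Sum>xs\<in>set_pmf P. pmf P xs * ?T xs)"
      unfolding sum_product sum.distrib[symmetric]
      by (intro sum.cong refl) (simp add: algebra_simps)
    then show ?case unfolding replicate_Suc S by (simp add: J IH1) }
  { case 2
    have "(\<Sum>x\<in>set_pmf q. \<Sum>xs\<in>set_pmf P. pmf q x * pmf P xs * (?T (x # xs))\<^sup>2)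
      = (\<Sum>x\<in>set_pmf q. pmf q x * (J x)\<^sup>2) * (\<Sum>xs\<in>set_pmf P. pmf P xs)
      + (\<Sum>x\<in>set_pmf q. pmf q x * J x) * (\<Sum>xs\<in>set_pmf P. 2 * (pmf P xs * ?T xs))
      + (\<Sum>x\<in>set_pmf q. pmf q x) * (\<Sum>xs\<in>set_pmf P. pmf P xs * (?T xs)\<^sup>2)"
      unfolding sum_product sum.distrib[symmetric]
      by (intro sum.cong refl) (simp add: power2_eq_square algebra_simps)
    then show ?case unfolding replicate_Suc S by (simp add: J IH2 one distrib_right) }
qed

section \<open>Entropy of a random hash\<close>

text \<open>A Jensen argument over the choice of the hash function. Given Y, the probability of the
  observed hash value, averaged over k, is at most the probability of the observed X plus the
  collision rate \<delta>; convexity of -ln moves the average inside.\<close>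

lemma cent_hash_ge:
  fixes \<phi> :: "'k \<Rightarrow> 'x \<Rightarrow> 'b" and \<delta> :: real
  assumes fin: "finite (set_pmf p)" and K: "finite K" and \<delta>: "\<delta> > 0"
    and coll: "\<And>\<omega> \<omega>'. \<omega> \<in> set_pmf p \<Longrightarrow> \<omega>' \<in> set_pmf p \<Longrightarrow> X \<omega> \<noteq> X \<omega>' \<Longrightarrow>
      card {k \<in> K. \<phi> k (X \<omega>) = \<phi> k (X \<omega>')} \<le> \<delta> * card K"
  shows "card K * (\<Sum>\<omega>\<in>set_pmf p. pmf p \<omega> *
      - ln (pmf (map_pmf (\<lambda>\<omega>. (X \<omega>, Y \<omega>)) p) (X \<omega>, Y \<omega>) / pmf (map_pmf Y p) (Y \<omega>) + \<delta>))
    \<le> (\<Sum>k\<in>K. cent p (\<lambda>\<omega>. \<phi> k (X \<omega>)) Y)"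
proof -
  define S where "S = set_pmf p"
  define Q where "Q = (\<lambda>\<omega>. pmf (map_pmf Y p) (Y \<omega>))"
  define s where "s = (\<lambda>\<omega>. pmf (map_pmf (\<lambda>\<omega>. (X \<omega>, Y \<omega>)) p) (X \<omega>, Y \<omega>) / Q \<omega> + \<delta>)"
  define g where "g = (\<lambda>k \<omega>. pmf (map_pmf (\<lambda>\<omega>. (\<phi> k (X \<omega>), Y \<omega>)) p) (\<phi> k (X \<omega>), Y \<omega>) / Q \<omega>)"
  have finS: "finite S" using fin by (simp add: S_def)
  have Q: "Q \<omega> > 0" if "\<omega> \<in> S" for \<omega> using that by (auto simp: S_def Q_def intro: pmf_map_pos)
  have s: "s \<omega> > 0" if "\<omega> \<in> S" for \<omega>
    using \<delta> by (auto simp: s_def Q_def intro!: add_nonneg_pos)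
  have g: "g k \<omega> > 0" if "\<omega> \<in> S" for k \<omega>
    using that Q pmf_map_pos[of \<omega> p "\<lambda>\<omega>. (\<phi> k (X \<omega>), Y \<omega>)"] by (auto simp: S_def g_def)
  \<comment> \<open>Exchange the sums: a sample point with the same X shares the hash value for
    every k, any other one for at most a fraction \<delta> of them.\<close>
  have g_sum: "(\<Sum>k\<in>K. g k \<omega>) \<le> card K * s \<omega>" if \<omega>: "\<omega> \<in> S" for \<omega>
  proof -
    let ?T = "{\<omega>' \<in> S. Y \<omega>' = Y \<omega>}"
    have "(\<Sum>k\<in>K. g k \<omega>) * Q \<omega> = (\<Sum>k\<in>K. \<Sum>\<omega>' | \<omega>' \<in> ?T \<and> \<phi> k (X \<omega>') = \<phi> k (X \<omega>). pmf p \<omega>')"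
      using Q[OF \<omega>] unfolding sum_distrib_right g_def pmf_map_eq_sum[OF fin] S_def
      by (intro sum.cong refl) (auto intro!: sum.cong)
    also have "\<dots> = (\<Sum>k\<in>K. \<Sum>\<omega>'\<in>?T. if \<phi> k (X \<omega>') = \<phi> k (X \<omega>) then pmf p \<omega>' else 0)"
      using finS by (intro sum.cong refl sum.inter_filter) auto
    also have "\<dots> = (\<Sum>\<omega>'\<in>?T. \<Sum>k\<in>K. if \<phi> k (X \<omega>') = \<phi> k (X \<omega>) then pmf p \<omega>' else 0)"
      by (rule sum.swap)
    also have "\<dots> = (\<Sum>\<omega>'\<in>?T. card {k \<in> K. \<phi> k (X \<omega>') = \<phi> k (X \<omega>)} * pmf p \<omega>')"
      using K by (simp add: sum.inter_filter[symmetric])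
    also have "\<dots> \<le> (\<Sum>\<omega>'\<in>?T. (if X \<omega>' = X \<omega> then card K * pmf p \<omega>' else 0) + \<delta> * card K * pmf p \<omega>')"
    proof (rule sum_mono)
      fix \<omega>' assume "\<omega>' \<in> ?T"
      then show "card {k \<in> K. \<phi> k (X \<omega>') = \<phi> k (X \<omega>)} * pmf p \<omega>'
          \<le> (if X \<omega>' = X \<omega> then card K * pmf p \<omega>' else 0) + \<delta> * card K * pmf p \<omega>'"
        using coll[of \<omega>' \<omega>] \<omega> \<delta> by (auto simp: S_def intro!: mult_right_mono)
    qed
    also have "\<dots> = card K * (\<Sum>\<omega>' | \<omega>' \<in> ?T \<and> X \<omega>' = X \<omega>. pmf p \<omega>') + \<delta> * card K * (\<Sum>\<omega>'\<in>?T. pmf p \<omega>')"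
      unfolding sum.distrib sum_distrib_left using finS by (subst sum.inter_filter) simp_all
    also have "(\<Sum>\<omega>' | \<omega>' \<in> ?T \<and> X \<omega>' = X \<omega>. pmf p \<omega>') = pmf (map_pmf (\<lambda>\<omega>. (X \<omega>, Y \<omega>)) p) (X \<omega>, Y \<omega>)"
      unfolding pmf_map_eq_sum[OF fin] S_def by (intro sum.cong) auto
    also have "(\<Sum>\<omega>'\<in>?T. pmf p \<omega>') = Q \<omega>"
      unfolding Q_def pmf_map_eq_sum[OF fin] S_def by (intro sum.cong) auto
    also have "card K * pmf (map_pmf (\<lambda>\<omega>. (X \<omega>, Y \<omega>)) p) (X \<omega>, Y \<omega>) + \<delta> * card K * Q \<omega> = card K * s \<omega> * Q \<omega>"
      using Q[OF \<omega>] by (simp add: s_def field_simps)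
    finally show ?thesis using Q[OF \<omega>] by simp
  qed
  have "card K * (\<Sum>\<omega>\<in>S. pmf p \<omega> * - ln (s \<omega>)) = (\<Sum>\<omega>\<in>S. pmf p \<omega> * - (card K * ln (s \<omega>)))"
    by (simp add: sum_distrib_left algebra_simps)
  also have "\<dots> \<le> (\<Sum>\<omega>\<in>S. pmf p \<omega> * - (\<Sum>k\<in>K. ln (g k \<omega>)))"
  proof (intro sum_mono mult_left_mono)
    fix \<omega> assume \<omega>: "\<omega> \<in> S"
    \<comment> \<open>Jensen's inequality through the tangent line of ln at s.\<close>
    have "(\<Sum>k\<in>K. ln (g k \<omega>)) \<le> (\<Sum>k\<in>K. ln (s \<omega>) + (g k \<omega> / s \<omega> - 1))"
    proof (rule sum_mono)
      fix k
      have "ln (g k \<omega> / s \<omega>) \<le> g k \<omega> / s \<omega> - 1"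
        using g[OF \<omega>] s[OF \<omega>] by (intro ln_le_minus_one) auto
      then show "ln (g k \<omega>) \<le> ln (s \<omega>) + (g k \<omega> / s \<omega> - 1)"
        using g[OF \<omega>, of k] s[OF \<omega>] by (simp add: ln_div)
    qed
    also have "\<dots> = card K * ln (s \<omega>) + ((\<Sum>k\<in>K. g k \<omega>) / s \<omega> - card K)"
      by (simp add: sum.distrib sum_subtractf sum_divide_distrib)
    also have "\<dots> \<le> card K * ln (s \<omega>)"
      using g_sum[OF \<omega>] s[OF \<omega>] by (simp add: field_simps)
    finally show "- (card K * ln (s \<omega>)) \<le> - (\<Sum>k\<in>K. ln (g k \<omega>))" by simp
  qed simp
  also have "\<dots> = (\<Sum>k\<in>K. \<Sum>\<omega>\<in>S. pmf p \<omega> * - ln (g k \<omega>))"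
    by (subst sum.swap) (simp add: sum_distrib_left sum_negf)
  finally show ?thesis
    by (simp add: cent_eq_sum g_def s_def S_def Q_def)
qed

text \<open>A sum is at most twice its larger term. So a hash with collision rate exp(-L) retains
  the smaller of the surprisal and L, up to ln 2.\<close>

lemma minus_ln_add_ge:
  fixes a b L :: real
  assumes "a > 0"
  shows "min (- ln a) L - ln 2 \<le> - ln (a + exp (- L))"
proof -
  define m where "m = max a (exp (- L))"
  have "m > 0" using assms by (simp add: m_def)
  have "ln (a + exp (- L)) \<le> ln (2 * m)"
    using assms by (subst ln_le_cancel_iff) (auto simp: m_def add_pos_pos)
  also have "\<dots> = ln 2 + ln m" using \<open>m > 0\<close> by (simp add: ln_mult)
  also have "ln m = max (ln a) (- L)"
    using assms by (auto simp: m_def max_def) (metis exp_le_cancel_iff exp_ln)+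
  finally show ?thesis by linarith
qed

text \<open>The conditional varentropy: the variance of the conditional surprisal, whose mean is
  \<open>cent q f g\<close> by \<open>cent_eq_sum\<close>.\<close>

definition info_variance :: "'a pmf \<Rightarrow> ('a \<Rightarrow> 'b) \<Rightarrow> ('a \<Rightarrow> 'c) \<Rightarrow> real" where
  "info_variance q f g = (\<Sum>x\<in>set_pmf q. pmf q x *
    (- ln (pmf (map_pmf (\<lambda>x. (f x, g x)) q) (f x, g x) / pmf (map_pmf g q) (g x)) - cent q f g)\<^sup>2)"

text \<open>For n independent copies the conditional surprisal is n times its mean plus a sum of
  centred terms, hence rarely far below L. The free parameter s is meant to be of the order of the
  square root of n, which makes the loss of that order too.\<close>

lemma cent_hash_list_pmf_ge:
  fixes \<phi> :: "'k \<Rightarrow> 'x list \<Rightarrow> 'b" and f :: "'a \<Rightarrow> 'x" and g :: "'a \<Rightarrow> 'y" and L s :: real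
  assumes fin: "finite (set_pmf q)" and K: "finite K" and L: "L \<le> n * cent q f g" and s: "s > 0"
    and coll: "\<And>xs ys. set xs \<subseteq> f ` set_pmf q \<Longrightarrow> set ys \<subseteq> f ` set_pmf q \<Longrightarrow> length xs = n \<Longrightarrow> length ys = n \<Longrightarrow>
        xs \<noteq> ys \<Longrightarrow> card {k \<in> K. \<phi> k xs = \<phi> k ys} \<le> exp (- L) * card K"
  shows "card K * (L - ln 2 - (n * info_variance q f g / s + s) / 2)
    \<le> (\<Sum>k\<in>K. cent (list_pmf (replicate n q)) (\<lambda>\<omega>. \<phi> k (map f \<omega>)) (map g))"
proof -
  define \<rho> where "\<rho> = (\<lambda>x. pmf (map_pmf (\<lambda>x. (f x, g x)) q) (f x, g x) / pmf (map_pmf g q) (g x))"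
  define c where "c = cent q f g"
  define J where "J = (\<lambda>x. - ln (\<rho> x) - c)"
  define V where "V = info_variance q f g"
  have V: "V = (\<Sum>x\<in>set_pmf q. pmf q x * (J x)\<^sup>2)"
    by (simp add: V_def info_variance_def J_def \<rho>_def c_def)
  have \<rho>: "\<rho> x > 0" if "x \<in> set_pmf q" for x
    unfolding \<rho>_def using that pmf_map_pos[OF that, of "\<lambda>x. (f x, g x)"] by (simp add: pmf_map_pos)
  have J: "(\<Sum>x\<in>set_pmf q. pmf q x * J x) = 0"
    using fin by (simp add: J_def c_def cent_eq_sum \<rho>_def right_diff_distrib sum_subtractf sum_negf sum_pmf_eq_1
        flip: sum_distrib_right)
  define P where "P = list_pmf (replicate n q)"
  have finP: "finite (set_pmf P)" using fin by (simp add: P_def finite_set_list_pmf)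
  have set: "set \<omega> \<subseteq> set_pmf q" "length \<omega> = n" if "\<omega> \<in> set_pmf P" for \<omega>
    using that set_list_pmf_replicate length_list_pmf[of \<omega> "replicate n q"] unfolding P_def by auto
  define a where "a = (\<lambda>\<omega>. pmf (map_pmf (\<lambda>\<omega>. (map f \<omega>, map g \<omega>)) P) (map f \<omega>, map g \<omega>) / pmf (map_pmf (map g) P) (map g \<omega>))"
  have a: "a \<omega> > 0" "- ln (a \<omega>) = n * c + (\<Sum>x\<leftarrow>\<omega>. J x)" if \<omega>: "\<omega> \<in> set_pmf P" for \<omega>
  proof -
    have eq: "(map f \<omega>, map g \<omega>) = (map f \<omega>', map g \<omega>') \<longleftrightarrow> map (\<lambda>x. (f x, g x)) \<omega> = map (\<lambda>x. (f x, g x)) \<omega>'" for \<omega> \<omega>'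
      by (auto simp: list_eq_iff_nth_eq)
    have "pmf (map_pmf (\<lambda>\<omega>. (map f \<omega>, map g \<omega>)) P) (map f \<omega>, map g \<omega>)
        = pmf (map_pmf (map (\<lambda>x. (f x, g x))) P) (map (\<lambda>x. (f x, g x)) \<omega>)"
      using eq by (intro antisym pmf_map_mono finP \<omega>) blast+
    then have a: "a \<omega> = (\<Prod>x\<leftarrow>\<omega>. pmf (map_pmf (\<lambda>x. (f x, g x)) q) (f x, g x)) / (\<Prod>x\<leftarrow>\<omega>. pmf (map_pmf g q) (g x))"
      using pmf_map_list_pmf_replicate[OF \<omega>[unfolded P_def], of g] pmf_map_list_pmf_replicate[OF \<omega>[unfolded P_def], of "\<lambda>x. (f x, g x)"]
      by (simp add: a_def P_def)
    have aux: "(\<Prod>x\<leftarrow>xs. pmf (map_pmf (\<lambda>x. (f x, g x)) q) (f x, g x)) / (\<Prod>x\<leftarrow>xs. pmf (map_pmf g q) (g x)) > 0 \<and>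
       - ln ((\<Prod>x\<leftarrow>xs. pmf (map_pmf (\<lambda>x. (f x, g x)) q) (f x, g x)) / (\<Prod>x\<leftarrow>xs. pmf (map_pmf g q) (g x)))
       = length xs * c + (\<Sum>x\<leftarrow>xs. J x)" if "set xs \<subseteq> set_pmf q" for xs
      using that
    proof (induction xs)
      case (Cons x xs)
      let ?r = "(\<Prod>x\<leftarrow>xs. pmf (map_pmf (\<lambda>x. (f x, g x)) q) (f x, g x)) / (\<Prod>x\<leftarrow>xs. pmf (map_pmf g q) (g x))"
      have eq: "(\<Prod>x\<leftarrow>x # xs. pmf (map_pmf (\<lambda>x. (f x, g x)) q) (f x, g x)) / (\<Prod>x\<leftarrow>x # xs. pmf (map_pmf g q) (g x)) = \<rho> x * ?r"
        by (simp add: \<rho>_def)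
      have r: "?r > 0" and rl: "- ln ?r = length xs * c + (\<Sum>x\<leftarrow>xs. J x)" using Cons by auto
      have "- ln (\<rho> x * ?r) = - ln (\<rho> x) + - ln ?r"
        using \<rho>[of x] r Cons.prems by (subst ln_mult) auto
      also have "\<dots> = length (x # xs) * c + (\<Sum>x\<leftarrow>x # xs. J x)"
        unfolding rl by (simp add: J_def algebra_simps)
      finally show ?case unfolding eq
        using mult_pos_pos[OF \<rho>[of x] r] Cons.prems by simp
    qed simp
    show "a \<omega> > 0" "- ln (a \<omega>) = n * c + (\<Sum>x\<leftarrow>\<omega>. J x)"
      using aux[OF set(1)[OF \<omega>]] set(2)[OF \<omega>] unfolding a by auto
  qed
  have "L - ln 2 - (n * V / s + s) / 2
      = (\<Sum>\<omega>\<in>set_pmf P. pmf P \<omega> * (L - ln 2 - ((\<Sum>x\<leftarrow>\<omega>. J x)\<^sup>2 / s + s) / 2))"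
  proof -
    have "(\<Sum>\<omega>\<in>set_pmf P. pmf P \<omega> * (L - ln 2 - ((\<Sum>x\<leftarrow>\<omega>. J x)\<^sup>2 / s + s) / 2))
      = (L - ln 2 - s / 2) * (\<Sum>\<omega>\<in>set_pmf P. pmf P \<omega>)
        - (\<Sum>\<omega>\<in>set_pmf P. pmf P \<omega> * (\<Sum>x\<leftarrow>\<omega>. J x)\<^sup>2) / (2 * s)"
      unfolding sum_distrib_left sum_divide_distrib sum_subtractf[symmetric]
      by (intro sum.cong refl) (use s in \<open>simp add: field_simps\<close>)
    also have "\<dots> = L - ln 2 - (n * V / s + s) / 2"
      using second_moment_list_pmf[OF fin J, of n] finP s
      by (simp add: sum_pmf_eq_1 P_def[symmetric] V[symmetric] field_simps)
    finally show ?thesis by simp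
  qed
  also have "\<dots> \<le> (\<Sum>\<omega>\<in>set_pmf P. pmf P \<omega> * - ln (a \<omega> + exp (- L)))"
  proof (intro sum_mono mult_left_mono)
    fix \<omega> assume \<omega>: "\<omega> \<in> set_pmf P"
    let ?t = "\<Sum>x\<leftarrow>\<omega>. J x"
    \<comment> \<open>The arithmetic-geometric mean inequality replaces the absolute deviation by
      its square, whose mean is known.\<close>
    have "0 \<le> (\<bar>?t\<bar> - s)\<^sup>2" by simp
    then have "2 * s * \<bar>?t\<bar> \<le> ?t\<^sup>2 + s\<^sup>2" by (simp add: power2_diff mult_ac)
    then have t: "\<bar>?t\<bar> \<le> (?t\<^sup>2 / s + s) / 2"
      using s by (simp add: field_simps power2_eq_square mult_ac)
    have "L - \<bar>?t\<bar> \<le> min (- ln (a \<omega>)) L"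
      using L unfolding a(2)[OF \<omega>] c_def by linarith
    then show "L - ln 2 - (?t\<^sup>2 / s + s) / 2 \<le> - ln (a \<omega> + exp (- L))"
      using minus_ln_add_ge[OF a(1)[OF \<omega>], of L] t by linarith
  qed simp
  finally have "card K * (L - ln 2 - (n * V / s + s) / 2)
      \<le> card K * (\<Sum>\<omega>\<in>set_pmf P. pmf P \<omega> * - ln (a \<omega> + exp (- L)))"
    by (intro mult_left_mono) auto
  also have "\<dots> \<le> (\<Sum>k\<in>K. cent P (\<lambda>\<omega>. \<phi> k (map f \<omega>)) (map g))"
    unfolding a_def
  proof (rule cent_hash_ge[OF finP K])
    fix \<omega> \<omega>' assume *: "\<omega> \<in> set_pmf P" "\<omega>' \<in> set_pmf P" "map f \<omega> \<noteq> map f \<omega>'"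
    show "card {k \<in> K. \<phi> k (map f \<omega>) = \<phi> k (map f \<omega>')} \<le> exp (- L) * card K"
      using set[OF *(1)] set[OF *(2)] *(3) by (intro coll) auto
  qed simp
  finally show ?thesis by (simp add: P_def V_def)
qed

section \<open>Entropy inequalities for conditional distributions\<close>

abbreviation lin_comb :: "rat \<Rightarrow> int \<times> int \<Rightarrow> rat" where
  "lin_comb r z \<equiv> of_int (fst z) + r * of_int (snd z)"

text \<open>One format for the given inequality, with coefficients 1, 0, b, and for the improved
  one, so that the passage to conditional entropies is proved once for both. An upper bound h takes
  the place of the maximum over R.\<close>

definition ent_ineq :: "rat set \<Rightarrow> real \<Rightarrow> real \<Rightarrow> real \<Rightarrow> bool" where
  "ent_ineq R a c b \<longleftrightarrow> (\<forall>(q :: (int \<times> int) pmf) h. finite (set_pmf q) \<longrightarrow>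
    (\<forall>r\<in>R. ent q (lin_comb r) \<le> h) \<longrightarrow> a * ent q snd + c * ent q (\<lambda>z. z) \<le> b * h)"

text \<open>Two distinct lists in F have the same value only in bases that are roots of a nonzero
  polynomial. Finitely many pairs exclude finitely many bases, so some natural number is
  left.\<close>

lemma ex_horner_sum_inj_on:
  fixes F :: "rat list set"
  assumes "finite F" and len: "\<And>xs. xs \<in> F \<Longrightarrow> length xs = N"
  obtains K :: nat where "inj_on (horner_sum (\<lambda>x. x) (of_nat K)) F"
proof -
  have poly: "horner_sum (\<lambda>x. x) k xs = poly (Poly xs) k" for k :: rat and xs
    by (induction xs) auto
  define B where "B = (\<Union>(xs, ys)\<in>{(xs, ys) \<in> F \<times> F. xs \<noteq> ys}. {k. poly (Poly xs - Poly ys) k = 0})"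
  \<comment> \<open>Equal lengths matter: lists that differ only by trailing zeros give the same
    polynomial.\<close>
  have neq: "Poly xs \<noteq> Poly ys" if F: "xs \<in> F" "ys \<in> F" and "xs \<noteq> ys" for xs ys
  proof
    assume "Poly xs = Poly ys"
    then have eq: "nth_default 0 xs i = nth_default 0 ys i" for i
      by (simp flip: coeff_Poly_eq)
    have "xs ! i = ys ! i" if "i < length xs" for i
      using eq[of i] that len[OF F(1)] len[OF F(2)] by (simp add: nth_default_nth)
    then have "xs = ys"
      using len[OF F(1)] len[OF F(2)] by (intro nth_equalityI) simp_all
    with \<open>xs \<noteq> ys\<close> show False ..
  qed
  have "finite {(xs, ys) \<in> F \<times> F. xs \<noteq> ys}"
    by (rule finite_subset[of _ "F \<times> F"]) (use \<open>finite F\<close> in auto)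
  then have "finite B"
    unfolding B_def
  proof (rule finite_UN_I, safe)
    fix xs ys assume "xs \<in> F" "ys \<in> F" "xs \<noteq> ys"
    then have "Poly xs - Poly ys \<noteq> 0" using neq[of xs ys] by simp
    then show "finite {k. poly (Poly xs - Poly ys) k = 0}" by (rule poly_roots_finite)
  qed
  moreover have "infinite (range (of_nat :: nat \<Rightarrow> rat))"
    by (rule range_inj_infinite[OF inj_of_nat])
  ultimately have "\<not> range (of_nat :: nat \<Rightarrow> rat) \<subseteq> B" using finite_subset by blast
  then obtain K :: nat where K: "of_nat K \<notin> B" by blast
  have "inj_on (horner_sum (\<lambda>x. x) (of_nat K)) F"
  proof (rule inj_onI, rule ccontr)
    fix xs ys assume *: "xs \<in> F" "ys \<in> F" "xs \<noteq> ys"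
      and "horner_sum (\<lambda>x. x) (of_nat K) xs = horner_sum (\<lambda>x. x) (rat_of_nat K) ys"
    then have "poly (Poly xs - Poly ys) (of_nat K) = 0" by (simp add: poly)
    with * K show False unfolding B_def by blast
  qed
  then show thesis by (rule that)
qed

text \<open>Entropy sees a function only through the partition into its fibres, so this is all that
  an encoding has to preserve.\<close>

definition same_fibres :: "'a set \<Rightarrow> ('a \<Rightarrow> 'b) \<Rightarrow> ('a \<Rightarrow> 'c) \<Rightarrow> bool" where
  "same_fibres S f g \<longleftrightarrow> (\<forall>\<omega>\<in>S. \<forall>\<omega>'\<in>S. f \<omega> = f \<omega>' \<longleftrightarrow> g \<omega> = g \<omega>')"

lemma ent_same_fibres: "finite (set_pmf p) \<Longrightarrow> same_fibres (set_pmf p) f g \<Longrightarrow> ent p f = ent p g"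
  unfolding same_fibres_def by (rule ent_eqI) blast+

lemma cent_same_fibres: "finite (set_pmf p) \<Longrightarrow> same_fibres (set_pmf p) f g \<Longrightarrow> cent p f w = cent p g w"
  unfolding same_fibres_def by (rule cent_eqI) blast+

definition int_encoding :: "'a set \<Rightarrow> rat set \<Rightarrow> ('a \<Rightarrow> (int \<times> int) list) \<Rightarrow> ('a \<Rightarrow> int \<times> int) \<Rightarrow> bool" where
  "int_encoding S R Z T \<longleftrightarrow>
    (\<forall>r\<in>R. same_fibres S (\<lambda>\<omega>. lin_comb r (T \<omega>)) (\<lambda>\<omega>. map (lin_comb r) (Z \<omega>))) \<and>
    same_fibres S (\<lambda>\<omega>. snd (T \<omega>)) (\<lambda>\<omega>. map snd (Z \<omega>)) \<and> same_fibres S T Z"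

text \<open>Lists of integers are packed into one integer by evaluating them as digits in a generic
  base, which is additive and hence compatible with all the linear combinations.\<close>

lemma ex_int_encoding:
  fixes Z :: "'a \<Rightarrow> (int \<times> int) list"
  assumes "finite S" "finite R" and len: "\<And>\<omega>. \<omega> \<in> S \<Longrightarrow> length (Z \<omega>) = N"
  shows "\<exists>T. int_encoding S R Z T"
proof -
  \<comment> \<open>The coefficient 0 is added because \<open>lin_comb 0\<close> is the first
    component, which together with the second recovers the whole pair.\<close>
  define F where "F = (\<Union>\<omega>\<in>S. (\<lambda>r. map (lin_comb r) (Z \<omega>)) ` insert 0 R \<union> {map (\<lambda>z. of_int (snd z)) (Z \<omega>)})"
  have "finite F" using assms by (auto simp: F_def)
  moreover have "length xs = N" if "xs \<in> F" for xs using that len by (auto simp: F_def)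
  ultimately obtain K :: nat where K: "inj_on (horner_sum (\<lambda>x. x) (of_nat K)) F"
    by (rule ex_horner_sum_inj_on)
  define T where "T = (\<lambda>\<omega>. (horner_sum fst (int K) (Z \<omega>), horner_sum snd (int K) (Z \<omega>)))"
  have T1: "lin_comb r (T \<omega>) = horner_sum (\<lambda>x. x) (of_nat K) (map (lin_comb r) (Z \<omega>))" for r \<omega>
  proof -
    have "lin_comb r (horner_sum fst (int K) zs, horner_sum snd (int K) zs)
        = horner_sum (\<lambda>x. x) (of_nat K) (map (lin_comb r) zs)" for zs
    proof (induction zs)
      case (Cons z zs)
      have "lin_comb r (horner_sum fst (int K) (z # zs), horner_sum snd (int K) (z # zs))
          = lin_comb r z + of_nat K * lin_comb r (horner_sum fst (int K) zs, horner_sum snd (int K) zs)"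
        by (simp add: algebra_simps)
      then show ?case unfolding Cons.IH by simp
    qed simp
    then show ?thesis by (simp add: T_def)
  qed
  have T2: "of_int (snd (T \<omega>)) = horner_sum (\<lambda>x. x) (of_nat K) (map (\<lambda>z. rat_of_int (snd z)) (Z \<omega>))" for \<omega>
  proof -
    have "of_int (horner_sum snd (int K) zs)
        = horner_sum (\<lambda>x. x) (of_nat K) (map (\<lambda>z. rat_of_int (snd z)) zs)" for zs :: "(int \<times> int) list"
      by (induction zs) auto
    then show ?thesis by (simp add: T_def)
  qed
  have *: "lin_comb r (T \<omega>) = lin_comb r (T \<omega>') \<longleftrightarrow> map (lin_comb r) (Z \<omega>) = map (lin_comb r) (Z \<omega>')"
    if "\<omega> \<in> S" "\<omega>' \<in> S" "r \<in> insert 0 R" for \<omega> \<omega>' r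
    unfolding T1 by (rule inj_on_eq_iff[OF K]) (use that in \<open>auto simp: F_def\<close>)
  have **: "snd (T \<omega>) = snd (T \<omega>') \<longleftrightarrow> map snd (Z \<omega>) = map snd (Z \<omega>')"
    if "\<omega> \<in> S" "\<omega>' \<in> S" for \<omega> \<omega>'
  proof -
    have "snd (T \<omega>) = snd (T \<omega>') \<longleftrightarrow> rat_of_int (snd (T \<omega>)) = rat_of_int (snd (T \<omega>'))" by simp
    also have "\<dots> \<longleftrightarrow> map (\<lambda>z. rat_of_int (snd z)) (Z \<omega>) = map (\<lambda>z. rat_of_int (snd z)) (Z \<omega>')"
      unfolding T2 by (rule inj_on_eq_iff[OF K]) (use that in \<open>auto simp: F_def\<close>)
    also have "\<dots> \<longleftrightarrow> map snd (Z \<omega>) = map snd (Z \<omega>')"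
      by (auto simp: list_eq_iff_nth_eq)
    finally show ?thesis .
  qed
  have 3: "same_fibres S T Z"
    unfolding same_fibres_def
  proof (intro ballI)
    fix \<omega> \<omega>' assume S: "\<omega> \<in> S" "\<omega>' \<in> S"
    have "T \<omega> = T \<omega>' \<longleftrightarrow> lin_comb 0 (T \<omega>) = lin_comb 0 (T \<omega>') \<and> snd (T \<omega>) = snd (T \<omega>')"
      by (auto simp: prod_eq_iff)
    also have "\<dots> \<longleftrightarrow> map (lin_comb 0) (Z \<omega>) = map (lin_comb 0) (Z \<omega>') \<and> map snd (Z \<omega>) = map snd (Z \<omega>')"
      using *[OF S, of 0] **[OF S] by blast
    also have "\<dots> \<longleftrightarrow> Z \<omega> = Z \<omega>'"
      using len[OF S(1)] len[OF S(2)] by (auto simp: list_eq_iff_nth_eq prod_eq_iff)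
    finally show "T \<omega> = T \<omega>' \<longleftrightarrow> Z \<omega> = Z \<omega>'" .
  qed
  have 2: "same_fibres S (\<lambda>\<omega>. snd (T \<omega>)) (\<lambda>\<omega>. map snd (Z \<omega>))"
    unfolding same_fibres_def by (intro ballI **)
  have 1: "same_fibres S (\<lambda>\<omega>. lin_comb r (T \<omega>)) (\<lambda>\<omega>. map (lin_comb r) (Z \<omega>))" if "r \<in> R" for r
    unfolding same_fibres_def using that by (intro ballI *) simp_all
  have "int_encoding S R Z T"
    unfolding int_encoding_def by (rule conjI[OF ballI conjI[OF 2 3]]) (erule 1)
  then show ?thesis by blast
qed

lemma ent_ineq_list:
  fixes Z :: "'a \<Rightarrow> (int \<times> int) list"
  assumes ineq: "ent_ineq R a c b" and R: "finite R" and fin: "finite (set_pmf p)"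
    and len: "\<And>\<omega>. \<omega> \<in> set_pmf p \<Longrightarrow> length (Z \<omega>) = N"
    and h: "\<And>r. r \<in> R \<Longrightarrow> ent p (\<lambda>\<omega>. map (lin_comb r) (Z \<omega>)) \<le> h"
  shows "a * ent p (\<lambda>\<omega>. map snd (Z \<omega>)) + c * ent p Z \<le> b * h"
proof -
  from ex_int_encoding[OF fin R, of Z N] len obtain T where "int_encoding (set_pmf p) R Z T" by blast
  then have T: "\<And>r. r \<in> R \<Longrightarrow> same_fibres (set_pmf p) (\<lambda>\<omega>. lin_comb r (T \<omega>)) (\<lambda>\<omega>. map (lin_comb r) (Z \<omega>))"
      "same_fibres (set_pmf p) (\<lambda>\<omega>. snd (T \<omega>)) (\<lambda>\<omega>. map snd (Z \<omega>))" "same_fibres (set_pmf p) T Z"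
    unfolding int_encoding_def by simp_all
  have 1: "ent (map_pmf T p) (lin_comb r) = ent p (\<lambda>\<omega>. map (lin_comb r) (Z \<omega>))" if "r \<in> R" for r
    unfolding ent_map_pmf[OF fin] by (rule ent_same_fibres[OF fin T(1)[OF that]])
  have 2: "ent (map_pmf T p) snd = ent p (\<lambda>\<omega>. map snd (Z \<omega>))"
    unfolding ent_map_pmf[OF fin] by (rule ent_same_fibres[OF fin T(2)])
  have 3: "ent (map_pmf T p) (\<lambda>z. z) = ent p Z"
    unfolding ent_map_pmf[OF fin] by (rule ent_same_fibres[OF fin T(3)])
  have "a * ent (map_pmf T p) snd + c * ent (map_pmf T p) (\<lambda>z. z) \<le> b * h"
    by (rule ineq[unfolded ent_ineq_def, rule_format]) (simp_all only: 1 h fin set_map_pmf finite_imageI)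
  then show ?thesis unfolding 2 3 .
qed

lemma sum_list_concat_replicate:
  fixes f :: "'b \<Rightarrow> real"
  assumes "distinct cs"
  shows "(\<Sum>x\<leftarrow>concat (map (\<lambda>c. replicate (n c) (q c)) cs). f x) = (\<Sum>c\<in>set cs. n c * f (q c))"
proof -
  have "(\<Sum>x\<leftarrow>concat (map (\<lambda>c. replicate (n c) (q c)) cs). f x) = (\<Sum>c\<leftarrow>cs. n c * f (q c))"
    by (induction cs) (auto simp: sum_list_replicate)
  then show ?thesis using assms by (simp add: sum_list_distinct_conv_sum_set)
qed

text \<open>The conditional distributions are combined by taking about \<open>N * P(w = c)\<close> independent copies
  of the one for \<open>w = c\<close>; the rounding errors are negligible as \<open>N\<close> grows.\<close>

lemma ent_ineq_cent_int:
  fixes Z :: "'a \<Rightarrow> int \<times> int"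
  assumes ineq: "ent_ineq R a c b" and R: "finite R" and fin: "finite (set_pmf p)"
    and h: "\<And>r. r \<in> R \<Longrightarrow> cent p (\<lambda>\<omega>. lin_comb r (Z \<omega>)) w \<le> h"
  shows "a * cent p (\<lambda>\<omega>. snd (Z \<omega>)) w + c * cent p Z w \<le> b * h"
proof -
  define C where "C = w ` set_pmf p"
  have finC: "finite C" using fin by (simp add: C_def)
  obtain cs where cs: "set cs = C" "distinct cs" using finite_distinct_list[OF finC] by blast
  define q where "q = (\<lambda>c. cond_pmf p {\<omega>. w \<omega> = c})"
  define \<pi> where "\<pi> = (\<lambda>c. pmf (map_pmf w p) c)"
  define \<phi> where "\<phi> = (\<lambda>d. a * ent (q d) (\<lambda>\<omega>. snd (Z \<omega>)) + c * ent (q d) Z)"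
  have finq: "finite (set_pmf (q d))" if "d \<in> C" for d
  proof -
    have "set_pmf p \<inter> {\<omega>. w \<omega> = d} \<noteq> {}" using that by (auto simp: C_def)
    then show ?thesis using fin by (simp add: q_def set_cond_pmf)
  qed
  define D where "D = a * cent p (\<lambda>\<omega>. snd (Z \<omega>)) w + c * cent p Z w"
  have D: "D = (\<Sum>d\<in>C. \<pi> d * \<phi> d)"
    by (simp add: D_def cent_eq_sum_cond_pmf[OF fin] \<phi>_def \<pi>_def q_def C_def sum.distrib
        sum_distrib_left algebra_simps)
  have bound: "N * (D - b * h) \<le> (\<Sum>d\<in>C. \<bar>\<phi> d\<bar>)" for N :: nat
  proof -
    \<comment> \<open>Rounding down keeps the entropy of each linear combination at most
      \<open>N * h\<close> exactly, so the whole error falls on the left-hand side.\<close>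
    define n where "n = (\<lambda>d. nat \<lfloor>N * \<pi> d\<rfloor>)"
    have n: "n d \<le> N * \<pi> d" "N * \<pi> d \<le> n d + 1" for d
    proof -
      have "N * \<pi> d \<ge> 0" by (simp add: \<pi>_def)
      then show "n d \<le> N * \<pi> d" "N * \<pi> d \<le> n d + 1"
        unfolding n_def by linarith+
    qed
    define qs where "qs = concat (map (\<lambda>d. replicate (n d) (q d)) cs)"
    have finqs: "\<forall>x\<in>set qs. finite (set_pmf x)"
      using finq cs by (auto simp: qs_def)
    have ent: "ent (list_pmf qs) (map f) = (\<Sum>d\<in>C. n d * ent (q d) f)" for f :: "'a \<Rightarrow> 'z"
      using sum_list_concat_replicate[OF cs(2), where n=n and q=q and f="\<lambda>x. ent x f"]
      unfolding ent_list_pmf[OF finqs] qs_def[symmetric] cs(1) .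
    have "a * ent (list_pmf qs) (\<lambda>\<omega>. map snd (map Z \<omega>)) + c * ent (list_pmf qs) (map Z) \<le> b * (N * h)"
    proof (rule ent_ineq_list[OF ineq R])
      show "finite (set_pmf (list_pmf qs))" using finqs by (rule finite_set_list_pmf)
      show "length (map Z \<omega>) = length qs" if "\<omega> \<in> set_pmf (list_pmf qs)" for \<omega>
        using length_list_pmf[OF that] by simp
      fix r assume r: "r \<in> R"
      have "ent (list_pmf qs) (\<lambda>\<omega>. map (lin_comb r) (map Z \<omega>))
          = (\<Sum>d\<in>C. n d * ent (q d) (\<lambda>\<omega>. lin_comb r (Z \<omega>)))"
        using ent[of "\<lambda>\<omega>. lin_comb r (Z \<omega>)"] by (simp add: comp_def)
      also have "\<dots> \<le> (\<Sum>d\<in>C. N * \<pi> d * ent (q d) (\<lambda>\<omega>. lin_comb r (Z \<omega>)))"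
        by (intro sum_mono mult_right_mono n ent_nonneg)
      also have "\<dots> = N * cent p (\<lambda>\<omega>. lin_comb r (Z \<omega>)) w"
        by (simp add: cent_eq_sum_cond_pmf[OF fin] C_def \<pi>_def q_def sum_distrib_left mult.assoc)
      also have "\<dots> \<le> N * h" by (intro mult_left_mono h r) simp
      finally show "ent (list_pmf qs) (\<lambda>\<omega>. map (lin_comb r) (map Z \<omega>)) \<le> N * h" .
    qed
    also have "a * ent (list_pmf qs) (\<lambda>\<omega>. map snd (map Z \<omega>)) + c * ent (list_pmf qs) (map Z)
        = (\<Sum>d\<in>C. n d * \<phi> d)"
      using ent[of Z] ent[of "\<lambda>\<omega>. snd (Z \<omega>)"]
      by (simp add: comp_def \<phi>_def sum.distrib sum_distrib_left algebra_simps)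
    finally have 1: "(\<Sum>d\<in>C. n d * \<phi> d) \<le> N * (b * h)" by (simp add: mult_ac)
    have "N * D = (\<Sum>d\<in>C. N * \<pi> d * \<phi> d)" by (simp add: D sum_distrib_left mult.assoc)
    also have "\<dots> \<le> (\<Sum>d\<in>C. n d * \<phi> d + \<bar>\<phi> d\<bar>)"
    proof (rule sum_mono)
      fix d
      have "(N * \<pi> d - n d) * \<phi> d \<le> \<bar>(N * \<pi> d - n d) * \<phi> d\<bar>" by simp
      also have "\<dots> \<le> 1 * \<bar>\<phi> d\<bar>"
        unfolding abs_mult using n[of d] by (intro mult_right_mono) auto
      finally show "N * \<pi> d * \<phi> d \<le> n d * \<phi> d + \<bar>\<phi> d\<bar>" by (simp add: algebra_simps)
    qed
    finally show ?thesis using 1 by (simp add: sum.distrib algebra_simps)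
  qed
  have "D - b * h \<le> 0"
  proof (rule ccontr)
    assume "\<not> D - b * h \<le> 0"
    then obtain N :: nat where "(\<Sum>d\<in>C. \<bar>\<phi> d\<bar>) < N * (D - b * h)"
      using reals_Archimedean3[of "D - b * h"] by auto
    then show False using bound[of N] by simp
  qed
  then show ?thesis by (simp add: D_def)
qed

text \<open>The form needed for hashing: w may depend on all entries of the list at once, so the
  list is packed as a whole before the conditional inequality is applied.\<close>

lemma ent_ineq_cent_list:
  fixes Z :: "'a \<Rightarrow> (int \<times> int) list"
  assumes ineq: "ent_ineq R a c b" and R: "finite R" and fin: "finite (set_pmf p)"
    and len: "\<And>\<omega>. \<omega> \<in> set_pmf p \<Longrightarrow> length (Z \<omega>) = N"
    and h: "\<And>r. r \<in> R \<Longrightarrow> cent p (\<lambda>\<omega>. map (lin_comb r) (Z \<omega>)) w \<le> h"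
  shows "a * cent p (\<lambda>\<omega>. map snd (Z \<omega>)) w + c * cent p Z w \<le> b * h"
proof -
  from ex_int_encoding[OF fin R, of Z N] len obtain T where "int_encoding (set_pmf p) R Z T" by blast
  then have T: "\<And>r. r \<in> R \<Longrightarrow> same_fibres (set_pmf p) (\<lambda>\<omega>. lin_comb r (T \<omega>)) (\<lambda>\<omega>. map (lin_comb r) (Z \<omega>))"
      "same_fibres (set_pmf p) (\<lambda>\<omega>. snd (T \<omega>)) (\<lambda>\<omega>. map snd (Z \<omega>))" "same_fibres (set_pmf p) T Z"
    unfolding int_encoding_def by simp_all
  have 1: "cent p (\<lambda>\<omega>. lin_comb r (T \<omega>)) w = cent p (\<lambda>\<omega>. map (lin_comb r) (Z \<omega>)) w" if "r \<in> R" for r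
    by (rule cent_same_fibres[OF fin T(1)[OF that]])
  have 2: "cent p (\<lambda>\<omega>. snd (T \<omega>)) w = cent p (\<lambda>\<omega>. map snd (Z \<omega>)) w"
    by (rule cent_same_fibres[OF fin T(2)])
  have 3: "cent p T w = cent p Z w"
    by (rule cent_same_fibres[OF fin T(3)])
  have "a * cent p (\<lambda>\<omega>. snd (T \<omega>)) w + c * cent p T w \<le> b * h"
    by (rule ent_ineq_cent_int[OF ineq R fin]) (simp only: 1 h)
  then show ?thesis unfolding 2 3 .
qed

section \<open>Linear hashing modulo a prime\<close>

lemma cent_le_ent: "finite (set_pmf p) \<Longrightarrow> cent p f w \<le> ent p f"
  using cent_antimono[of p w "\<lambda>_. ()" f] ent_eqI[of p "\<lambda>\<omega>. (f \<omega>, ())" f]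
  by (simp add: cent_def)

lemma ent_pair_le: "finite (set_pmf p) \<Longrightarrow> ent p (\<lambda>\<omega>. (f \<omega>, g \<omega>)) \<le> ent p f + ent p g"
  using cent_le_ent[of p f g] by (simp add: cent_def)

text \<open>As v j is invertible modulo p, a solution is determined by its coefficients at the
  indices other than j.\<close>

lemma card_linear_forms_vanish:
  fixes v :: "nat \<Rightarrow> int"
  assumes p: "prime p" and j: "j < n" "\<not> int p dvd v j"
  shows "card {a \<in> {..<n} \<rightarrow>\<^sub>E {..<p}. int p dvd (\<Sum>i<n. int (a i) * v i)} * p \<le> p ^ n"
proof -
  let ?Z = "{a \<in> {..<n} \<rightarrow>\<^sub>E {..<p}. int p dvd (\<Sum>i<n. int (a i) * v i)}"
  let ?I = "{..<n} - {j}"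
  have "inj_on (\<lambda>a. restrict a ?I) ?Z"
  proof (rule inj_onI)
    fix a b assume ab: "a \<in> ?Z" "b \<in> ?Z" and eq: "restrict a ?I = restrict b ?I"
    have off: "a i = b i" if "i \<in> ?I" for i using fun_cong[OF eq, of i] that by simp
    have "(\<Sum>i<n. int (a i) * v i) - (\<Sum>i<n. int (b i) * v i) = (\<Sum>i<n. (int (a i) - int (b i)) * v i)"
      by (simp add: sum_subtractf left_diff_distrib)
    also have "\<dots> = (int (a j) - int (b j)) * v j + (\<Sum>i\<in>?I. (int (a i) - int (b i)) * v i)"
      using j by (intro sum.remove) auto
    also have "(\<Sum>i\<in>?I. (int (a i) - int (b i)) * v i) = 0"
      by (rule sum.neutral) (simp add: off)
    finally have "int p dvd (int (a j) - int (b j)) * v j"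
      using ab dvd_diff[of "int p" "\<Sum>i<n. int (a i) * v i" "\<Sum>i<n. int (b i) * v i"] by simp
    then have "int p dvd int (a j) - int (b j)"
      using p j(2) by (simp add: prime_dvd_mult_iff)
    moreover have "a j < p" "b j < p" using ab j by auto
    ultimately have "a j = b j"
      by (auto simp: mod_eq_dvd_iff[symmetric])
    show "a = b"
    proof
      fix i show "a i = b i"
      proof (cases "i < n")
        case True
        then show ?thesis using off \<open>a j = b j\<close> by (cases "i = j") auto
      next
        case False
        have "a \<in> {..<n} \<rightarrow>\<^sub>E {..<p}" "b \<in> {..<n} \<rightarrow>\<^sub>E {..<p}" using ab by auto
        from this[THEN PiE_arb, of i] False show ?thesis by simp
      qed
    qed
  qed
  moreover have "(\<lambda>a. restrict a ?I) ` ?Z \<subseteq> ?I \<rightarrow>\<^sub>E {..<p}"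
    by (intro image_subsetI) (auto simp: restrict_PiE_iff)
  moreover have "finite (?I \<rightarrow>\<^sub>E {..<p})" by (rule finite_PiE) auto
  ultimately have "card ?Z \<le> card (?I \<rightarrow>\<^sub>E {..<p})" by (rule card_inj_on_le)
  also have "\<dots> = p ^ (n - 1)" using j by (simp add: card_PiE)
  finally have "card ?Z * p \<le> p ^ (n - 1) * p" by simp
  also have "\<dots> = p ^ n" using j by (cases n) auto
  finally show ?thesis .
qed

definition hash_matrices :: "nat \<Rightarrow> nat \<Rightarrow> nat \<Rightarrow> (nat \<Rightarrow> nat \<Rightarrow> nat) set" where
  "hash_matrices p m n = {..<m} \<rightarrow>\<^sub>E ({..<n} \<rightarrow>\<^sub>E {..<p})"

definition lin_hash :: "nat \<Rightarrow> nat \<Rightarrow> nat \<Rightarrow> (nat \<Rightarrow> nat \<Rightarrow> nat) \<Rightarrow> int list \<Rightarrow> int list" where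
  "lin_hash p m n A xs = map (\<lambda>i. (\<Sum>j<n. int (A i j) * xs ! j) mod int p) [0..<m]"

lemma lin_hash_eq_iff:
  "lin_hash p m n A xs = lin_hash p m n A ys \<longleftrightarrow>
    (\<forall>i<m. int p dvd (\<Sum>j<n. int (A i j) * (xs ! j - ys ! j)))"
  by (auto simp: lin_hash_def mod_eq_dvd_iff sum_subtractf right_diff_distrib)

lemma finite_hash_matrices: "finite (hash_matrices p m n)"
  unfolding hash_matrices_def by (intro finite_PiE) auto

lemma card_hash_matrices: "card (hash_matrices p m n) = (p ^ n) ^ m"
  by (simp add: hash_matrices_def card_PiE)

text \<open>In a collision each of the m rows annihilates the difference vector modulo p, and at
  most a fraction 1/p of the possible rows does so. The rows are chosen independently, which gives
  p^(-m) = exp(-(m ln p)).\<close>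

lemma card_lin_hash_collision:
  assumes p: "prime p" and len: "length xs = n" "length ys = n"
    and ndvd: "\<And>j. j < n \<Longrightarrow> xs ! j \<noteq> ys ! j \<Longrightarrow> \<not> int p dvd xs ! j - ys ! j" and "xs \<noteq> ys"
  shows "card {A \<in> hash_matrices p m n. lin_hash p m n A xs = lin_hash p m n A ys}
    \<le> exp (- (m * ln p)) * card (hash_matrices p m n)"
proof -
  let ?Z = "{a \<in> {..<n} \<rightarrow>\<^sub>E {..<p}. int p dvd (\<Sum>i<n. int (a i) * (xs ! i - ys ! i))}"
  have p0: "p > 0" using p by (rule prime_gt_0_nat)
  obtain j where j: "j < n" "xs ! j \<noteq> ys ! j"
    using len \<open>xs \<noteq> ys\<close> by (auto simp: list_eq_iff_nth_eq)
  have "{A \<in> hash_matrices p m n. lin_hash p m n A xs = lin_hash p m n A ys} = {..<m} \<rightarrow>\<^sub>E ?Z"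
    unfolding hash_matrices_def lin_hash_eq_iff by (auto simp: PiE_iff extensional_def)
  then have "card {A \<in> hash_matrices p m n. lin_hash p m n A xs = lin_hash p m n A ys} = card ?Z ^ m"
    by (simp add: card_PiE)
  moreover have "card ?Z * p \<le> p ^ n"
    by (rule card_linear_forms_vanish[OF p j(1)]) (rule ndvd[OF j])
  then have "(card ?Z * p) ^ m \<le> (p ^ n) ^ m" by (rule power_mono) simp
  ultimately have "card {A \<in> hash_matrices p m n. lin_hash p m n A xs = lin_hash p m n A ys} * p ^ m
      \<le> card (hash_matrices p m n)"
    unfolding card_hash_matrices by (simp only: power_mult_distrib)
  then have "real (card {A \<in> hash_matrices p m n. lin_hash p m n A xs = lin_hash p m n A ys}) * p ^ m
      \<le> card (hash_matrices p m n)"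
    unfolding of_nat_power[symmetric] of_nat_mult[symmetric] of_nat_le_iff .
  moreover have e: "exp (- (m * ln p)) = 1 / p ^ m"
    using p0 by (simp add: exp_minus exp_of_nat_mult inverse_eq_divide)
  ultimately show ?thesis unfolding e using p0 by (simp add: field_simps)
qed

lemma ent_lin_hash_le:
  assumes "finite (set_pmf q)" and p: "p > 0"
  shows "ent q (\<lambda>\<omega>. lin_hash p m n A (f \<omega>)) \<le> m * ln p"
proof -
  let ?B = "{xs. set xs \<subseteq> {0..<int p} \<and> length xs = m}"
  have "(\<lambda>\<omega>. lin_hash p m n A (f \<omega>)) ` set_pmf q \<subseteq> ?B"
    using p by (auto simp: lin_hash_def)
  then have "ent q (\<lambda>\<omega>. lin_hash p m n A (f \<omega>)) \<le> ln (card ?B)"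
    by (intro ent_le_ln_card assms finite_lists_length_eq) auto
  also have "card ?B = p ^ m" by (simp add: card_lists_length_eq)
  finally show ?thesis using p by (simp add: ln_realpow)
qed

text \<open>With r = e/d, equal combinations mean that d times the difference of the X parts is -e
  times the difference of the Y parts. This passes through the linear hash, and d cancels modulo
  p.\<close>

lemma lin_hash_lin_comb:
  assumes p: "prime p" and d: "\<not> int p dvd snd (quotient_of r)"
    and len: "length zs = n" "length zs' = n"
    and eq: "map (lin_comb r) zs = map (lin_comb r) zs'"
    and hash: "lin_hash p m n A (map snd zs) = lin_hash p m n A (map snd zs')"
  shows "lin_hash p m n A (map fst zs) = lin_hash p m n A (map fst zs')"
proof -
  obtain e d where ed: "quotient_of r = (e, d)" by fastforce
  have d0: "d > 0" using quotient_of_denom_pos[OF ed] .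
  have r: "r = of_int e / of_int d" using quotient_of_div[OF ed] .
  have key: "d * (fst (zs ! j) - fst (zs' ! j)) = - e * (snd (zs ! j) - snd (zs' ! j))" if "j < n" for j
  proof -
    have "lin_comb r (zs ! j) = lin_comb r (zs' ! j)"
      using arg_cong[OF eq, of "\<lambda>xs. xs ! j"] that len by simp
    then have "rat_of_int (d * (fst (zs ! j) - fst (zs' ! j))) = rat_of_int (- e * (snd (zs ! j) - snd (zs' ! j)))"
      using d0 by (simp add: r field_simps)
    then show ?thesis by (simp only: of_int_eq_iff)
  qed
  show ?thesis
    unfolding lin_hash_eq_iff
  proof (intro allI impI)
    fix i assume i: "i < m"
    have "d * (\<Sum>j<n. int (A i j) * (map fst zs ! j - map fst zs' ! j))
        = (\<Sum>j<n. int (A i j) * (d * (fst (zs ! j) - fst (zs' ! j))))"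
      using len by (simp add: sum_distrib_left mult.left_commute)
    also have "\<dots> = - e * (\<Sum>j<n. int (A i j) * (map snd zs ! j - map snd zs' ! j))"
      using len by (simp add: key sum_distrib_left mult.left_commute)
    finally have "int p dvd d * (\<Sum>j<n. int (A i j) * (map fst zs ! j - map fst zs' ! j))"
      using hash i unfolding lin_hash_eq_iff by (simp del: mult_minus_left)
    then show "int p dvd (\<Sum>j<n. int (A i j) * (map fst zs ! j - map fst zs' ! j))"
      using p d ed by (simp add: prime_dvd_mult_iff)
  qed
qed

lemma ex_prime_not_dvd:
  assumes "finite D"
  obtains p :: nat where "prime p" "\<And>d. d \<in> D \<Longrightarrow> d \<noteq> 0 \<Longrightarrow> \<not> int p dvd d"
proof -
  obtain p where p: "prime p" "nat (Max (insert 0 (abs ` D))) < p"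
    using bigger_prime by blast
  have "\<not> int p dvd d" if "d \<in> D" "d \<noteq> 0" for d
  proof
    assume "int p dvd d"
    then have "int p \<le> \<bar>d\<bar>" using that by (metis dvd_imp_le_int abs_of_nat)
    also have "\<bar>d\<bar> \<le> Max (insert 0 (abs ` D))" using that assms by (intro Max_ge) auto
    finally show False using p(2) by linarith
  qed
  with p(1) show thesis by (rule that)
qed

text \<open>As H(X,Y) = H(Y) + H(X|Y), the conclusion says H(Y) + (b - 1) H(X|Y) <= b h. Stating it
  through the joint entropy fits it to \<open>ent_ineq\<close>, hence to conditioning.\<close>

theorem ent_ineq_joint:
  assumes ineq: "ent_ineq R 1 0 b" and R: "finite R" "R \<noteq> {}" and b: "b \<ge> 1"
  shows "ent_ineq R (2 - b) (b - 1) b"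
  unfolding ent_ineq_def
proof (intro allI impI)
  fix q :: "(int \<times> int) pmf" and h :: real
  assume fin: "finite (set_pmf q)" and h: "\<forall>r\<in>R. ent q (lin_comb r) \<le> h"
  define k where "k = cent q fst snd"
  have k: "ent q (\<lambda>z. z) = ent q snd + k" by (simp add: k_def cent_def)
  have "ent q snd + (b - 1) * k \<le> b * h"
  \<comment> \<open>A hash of Y can carry k per copy only if H(Y) is at least k. Otherwise H(Y) + (b
    - 1) k < b k, and k <= h is enough.\<close>
  proof (cases "ent q snd < k")
    case True
    obtain r where r: "r \<in> R" using R by blast
    \<comment> \<open>Given Y, the variables X and X + rY determine each other.\<close>
    have "k = cent q (lin_comb r) snd" unfolding k_def by (rule cent_eqI[OF fin]) auto
    also have "\<dots> \<le> h" using cent_le_ent[OF fin] h r by (meson order_trans)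
    finally have "b * k \<le> b * h" using b by simp
    then show ?thesis using True by (simp add: algebra_simps)
  next
    case False
    define E where "E = fst ` set_pmf q \<union> snd ` set_pmf q"
    \<comment> \<open>What the prime must not divide: differences of values, so that distinct values
      stay distinct modulo p, and the denominators of R.\<close>
    define D where "D = (\<lambda>(x, y). x - y) ` (E \<times> E) \<union> (\<lambda>r. snd (quotient_of r)) ` R"
    have "finite D" using fin R by (simp add: D_def E_def)
    then obtain p :: nat where p: "prime p" and pD: "\<And>d. d \<in> D \<Longrightarrow> d \<noteq> 0 \<Longrightarrow> \<not> int p dvd d"
      using ex_prime_not_dvd by blast
    have p0: "p > 0" "ln p > 0" using prime_gt_1_nat[OF p] by auto
    define V1 where "V1 = info_variance q fst snd"
    define V2 where "V2 = info_variance q snd (\<lambda>_. ())"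
    \<comment> \<open>Collects all losses after division by N; it must not depend on N.\<close>
    define C where "C = b * (2 * ln 2 + (V1 + V2 + 2) / 2) + (b - 1) * ln p"
    have bound: "N * (ent q snd + (b - 1) * k - b * h) \<le> C" if N: "N > 0" for N :: nat
    proof -
      \<comment> \<open>With n = N^2 copies and s = N, the deviation term n V / s + s is N (V + 1),
        of lower order than n.\<close>
      define n where "n = N * N"
      \<comment> \<open>The largest number of rows with m ln p <= n k; rounding costs at most ln
        p.\<close>
      define m where "m = nat \<lfloor>n * k / ln p\<rfloor>"
      define L where "L = m * ln p"
      define \<epsilon> where "\<epsilon> = 2 * ln 2 + N * (V1 + V2 + 2) / 2"
      define P where "P = list_pmf (replicate n q)"
      define K where "K = hash_matrices p m n"
      have k0: "k \<ge> 0" unfolding k_def by (rule cent_nonneg[OF fin])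
      then have "n * k / ln p \<ge> 0" using p0 by simp
      then have "m \<le> n * k / ln p" "n * k / ln p \<le> m + 1" unfolding m_def by linarith+
      then have L: "L \<le> n * k" "n * k - ln p \<le> L" using p0 by (simp_all add: L_def field_simps)
      have finP: "finite (set_pmf P)" using fin by (simp add: P_def finite_set_list_pmf)
      have lenP: "length \<omega> = n" if "\<omega> \<in> set_pmf P" for \<omega>
        using length_list_pmf[OF that[unfolded P_def]] by simp
      have K: "finite K" "card K > 0"
        unfolding K_def card_hash_matrices using p0 by (simp_all add: finite_hash_matrices)
      have coll: "card {A \<in> K. lin_hash p m n A xs = lin_hash p m n A ys} \<le> exp (- L) * card K"
        if "set xs \<subseteq> E" "set ys \<subseteq> E" "length xs = n" "length ys = n" "xs \<noteq> ys" for xs ys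
        unfolding K_def L_def
      proof (rule card_lin_hash_collision[OF p that(3,4) _ that(5)])
        fix j assume j: "j < n" "xs ! j \<noteq> ys ! j"
        have "xs ! j \<in> E" "ys ! j \<in> E" using that(1-4) j(1) nth_mem[of j xs] nth_mem[of j ys] by auto
        then have "(case (xs ! j, ys ! j) of (x, y) \<Rightarrow> x - y) \<in> D" unfolding D_def by blast
        then have "xs ! j - ys ! j \<in> D" by simp
        then show "\<not> int p dvd xs ! j - ys ! j" using pD j by simp
      qed
      let ?\<phi> = "lin_hash p m n"
      let ?X = "\<lambda>A \<omega>. ?\<phi> A (map fst \<omega>)" and ?Y = "\<lambda>A \<omega>. ?\<phi> A (map snd \<omega>)"
      have "card K * (L - ln 2 - (n * V1 / N + N) / 2) \<le> (\<Sum>A\<in>K. cent P (?X A) (map snd))"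
        unfolding P_def V1_def
      proof (rule cent_hash_list_pmf_ge[OF fin K(1)])
        show "L \<le> n * cent q fst snd" using L by (simp add: k_def)
        show "card {A \<in> K. ?\<phi> A xs = ?\<phi> A ys} \<le> exp (- L) * card K"
          if "set xs \<subseteq> fst ` set_pmf q" "set ys \<subseteq> fst ` set_pmf q" "length xs = n" "length ys = n" "xs \<noteq> ys"
          for xs ys
          by (rule coll) (use that in \<open>simp_all add: E_def le_supI1\<close>)
      qed (use N in simp)
      \<comment> \<open>Conditioning on a constant makes the same estimate bound the plain entropy
        of the hash of Y.\<close>
      moreover have "card K * (L - ln 2 - (n * V2 / N + N) / 2) \<le> (\<Sum>A\<in>K. cent P (?Y A) (map (\<lambda>_. ())))"
        unfolding P_def V2_def
      proof (rule cent_hash_list_pmf_ge[OF fin K(1)])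
        have "ent q (\<lambda>z. (snd z, ())) = ent q snd" by (rule ent_eqI[OF fin]) auto
        then have "k \<le> cent q snd (\<lambda>_. ())" using False by (simp add: cent_def)
        then have "n * k \<le> n * cent q snd (\<lambda>_. ())" by (intro mult_left_mono) auto
        then show "L \<le> n * cent q snd (\<lambda>_. ())" using L by linarith
        show "card {A \<in> K. ?\<phi> A xs = ?\<phi> A ys} \<le> exp (- L) * card K"
          if "set xs \<subseteq> snd ` set_pmf q" "set ys \<subseteq> snd ` set_pmf q" "length xs = n" "length ys = n" "xs \<noteq> ys"
          for xs ys
          by (rule coll) (use that in \<open>simp_all add: E_def le_supI2\<close>)
      qed (use N in simp)
      moreover have "(\<Sum>A\<in>K. cent P (?Y A) (map (\<lambda>_. ()))) \<le> (\<Sum>A\<in>K. ent P (?Y A))"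
        by (intro sum_mono cent_le_ent finP)
      moreover have "card K * (L - ln 2 - (n * V1 / N + N) / 2) + card K * (L - ln 2 - (n * V2 / N + N) / 2)
          = card K * (2 * L - \<epsilon>)"
        using N by (simp add: n_def \<epsilon>_def field_simps)
      ultimately have "card K * (2 * L - \<epsilon>) \<le> (\<Sum>A\<in>K. cent P (?X A) (map snd) + ent P (?Y A))"
        by (simp add: sum.distrib)
      \<comment> \<open>Averaging the sum of both entropies gives one matrix that serves both. As
        the hash of Y has entropy at most L, the hash of X given Y keeps at least L -
        \<epsilon>.\<close>
      then obtain A where A: "2 * L - \<epsilon> \<le> cent P (?X A) (map snd) + ent P (?Y A)"
        using sum_bounded_above_strict[of K "\<lambda>A. cent P (?X A) (map snd) + ent P (?Y A)" "2 * L - \<epsilon>"] K(2)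
        by (meson leD leI)
      define \<alpha> where "\<alpha> = cent P (?X A) (map snd)"
      define w where "w = (\<lambda>\<omega>. (?X A \<omega>, ?Y A \<omega>))"
      have Y_le: "ent P (?Y A) \<le> L" unfolding L_def by (rule ent_lin_hash_le[OF finP p0(1)])
      then have \<alpha>: "L - \<epsilon> \<le> \<alpha>" using A by (simp add: \<alpha>_def)
      \<comment> \<open>The hash of Y is a function of Y, so conditioning on the hash alone leaves
        at least as much entropy.\<close>
      have "cent P (?X A) (map snd) \<le> cent P (?X A) (?Y A)" by (rule cent_antimono[OF finP]) auto
      then have w: "2 * L - \<epsilon> \<le> ent P w" using A by (simp add: w_def cent_def)
      \<comment> \<open>The crucial saving: next to the linear combination, w contributes no more
        than the hash of Y, at most L, although its own entropy is nearly 2 L.\<close>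
      have cent_le: "cent P (\<lambda>\<omega>. map (lin_comb r) \<omega>) w \<le> n * h + L - ent P w" if r: "r \<in> R" for r
      proof -
        have "snd (quotient_of r) > 0" by (rule quotient_of_denom_pos') 
        moreover have "snd (quotient_of r) \<in> D" using r by (simp add: D_def)
        ultimately have d: "\<not> int p dvd snd (quotient_of r)" using pD by fastforce
        have "ent P (\<lambda>\<omega>. (map (lin_comb r) \<omega>, w \<omega>)) \<le> ent P (\<lambda>\<omega>. (map (lin_comb r) \<omega>, ?Y A \<omega>))"
        proof (rule ent_mono[OF finP])
          fix \<omega> \<omega>' assume "\<omega> \<in> set_pmf P" "\<omega>' \<in> set_pmf P"
            and "(map (lin_comb r) \<omega>, ?Y A \<omega>) = (map (lin_comb r) \<omega>', ?Y A \<omega>')"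
          then show "(map (lin_comb r) \<omega>, w \<omega>) = (map (lin_comb r) \<omega>', w \<omega>')"
            using lin_hash_lin_comb[OF p d lenP lenP] unfolding w_def prod.inject by blast
        qed
        also have "\<dots> \<le> ent P (map (lin_comb r)) + ent P (?Y A)" by (rule ent_pair_le[OF finP])
        also have "ent P (map (lin_comb r)) = n * ent q (lin_comb r)"
          using fin by (simp add: P_def ent_list_pmf sum_list_replicate)
        also have "n * ent q (lin_comb r) + ent P (?Y A) \<le> n * h + L"
          using h r Y_le by (intro add_mono mult_left_mono) auto
        finally show ?thesis by (simp add: cent_def)
      qed
      have "1 * cent P (\<lambda>\<omega>. map snd \<omega>) w + 0 * cent P (\<lambda>\<omega>. \<omega>) w \<le> b * (n * h + L - ent P w)"
        using ineq R(1) finP lenP cent_le by (rule ent_ineq_cent_list)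
      \<comment> \<open>Next to Y only the hash of X is new, and it contributes \<alpha>.\<close>
      moreover have "cent P (\<lambda>\<omega>. map snd \<omega>) w = n * ent q snd + \<alpha> - ent P w"
      proof -
        have "ent P (\<lambda>\<omega>. (map snd \<omega>, w \<omega>)) = ent P (\<lambda>\<omega>. (?X A \<omega>, map snd \<omega>))"
          by (rule ent_eqI[OF finP]) (auto simp: w_def)
        moreover have "ent P (map snd) = n * ent q snd"
          using fin by (simp add: P_def ent_list_pmf sum_list_replicate)
        ultimately show ?thesis by (simp add: cent_def \<alpha>_def)
      qed
      ultimately have "n * ent q snd + \<alpha> + (b - 1) * ent P w \<le> b * (n * h + L)"
        by (simp add: algebra_simps)
      moreover have "(b - 1) * (2 * L - \<epsilon>) \<le> (b - 1) * ent P w"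
        using w b by (intro mult_left_mono) auto
      ultimately have "n * ent q snd + (L - \<epsilon>) + (b - 1) * (2 * L - \<epsilon>) \<le> b * (n * h + L)"
        using \<alpha> by linarith
      then have "n * ent q snd + (b - 1) * L \<le> b * n * h + b * \<epsilon>"
        by (simp add: algebra_simps)
      moreover have "(b - 1) * (n * k - ln p) \<le> (b - 1) * L"
        using L b by (intro mult_left_mono) auto
      ultimately have "n * ent q snd + (b - 1) * (n * k - ln p) \<le> b * n * h + b * \<epsilon>" by linarith
      then have "n * (ent q snd + (b - 1) * k - b * h) \<le> b * \<epsilon> + (b - 1) * ln p"
        by (simp add: algebra_simps)
      also have "\<dots> \<le> b * (N * (2 * ln 2 + (V1 + V2 + 2) / 2)) + N * ((b - 1) * ln p)"
      proof (intro add_mono mult_left_mono)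
        have "1 * (2 * ln 2) \<le> N * (2 * ln (2::real))" using N by (intro mult_right_mono) auto
        then show "\<epsilon> \<le> N * (2 * ln 2 + (V1 + V2 + 2) / 2)" by (simp add: \<epsilon>_def algebra_simps)
        have "1 * ((b - 1) * ln p) \<le> N * ((b - 1) * ln p)" using N p0 b by (intro mult_right_mono) auto
        then show "(b - 1) * ln p \<le> N * ((b - 1) * ln p)" by simp
      qed (use b in simp)
      also have "\<dots> = N * C" by (simp add: C_def algebra_simps)
      finally have "N * (N * (ent q snd + (b - 1) * k - b * h)) \<le> N * C"
        by (simp add: n_def mult.assoc)
      then show ?thesis using N by simp
    qed
    show ?thesis
    proof (rule ccontr)
      assume "\<not> ?thesis"
      then have pos: "ent q snd + (b - 1) * k - b * h > 0" by simp
      then obtain N :: nat where N: "\<bar>C\<bar> < N * (ent q snd + (b - 1) * k - b * h)"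
        using reals_Archimedean3 by blast
      then have "N > 0" by (cases N) auto
      from bound[OF this] N show False by linarith
    qed
  qed
  then show "(2 - b) * ent q snd + (b - 1) * ent q (\<lambda>z. z) \<le> b * h"
    unfolding k by (simp add: algebra_simps)
qed

section \<open>The inequality in several variables\<close>

lemma ex_common_denominator:
  fixes F :: "rat set"
  assumes "finite F"
  shows "\<exists>d::int. d > 0 \<and> (\<forall>x\<in>F. of_int d * x \<in> \<int>)"
  using assms
proof induction
  case empty
  show ?case by (rule exI[of _ 1]) simp
next
  case (insert x F)
  then obtain d :: int where d: "d > 0" "\<forall>x\<in>F. of_int d * x \<in> \<int>" by blast
  obtain a e where q: "quotient_of x = (a, e)" by fastforce
  have e: "e > 0" "x = of_int a / of_int e"
    using quotient_of_denom_pos[OF q] quotient_of_div[OF q] by auto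
  have "of_int (d * e) * x = of_int (d * a)" using e by simp
  then have "of_int (d * e) * x \<in> \<int>" by (simp only: Ints_of_int)
  moreover have "of_int (d * e) * y \<in> \<int>" if "y \<in> F" for y
  proof -
    have "of_int (d * e) * y = of_int e * (of_int d * y)" by simp
    then show ?thesis using d that by (simp only: Ints_mult Ints_of_int)
  qed
  ultimately show ?case using d e by (intro exI[of _ "d * e"]) auto
qed

text \<open>In the induction over coordinates X absorbs rational multiples of the others.
  Multiplying by a common denominator restores integers and leaves all fibres unchanged.\<close>

lemma ent_ineq_cent_rat:
  fixes X Y :: "'a \<Rightarrow> rat"
  assumes ineq: "ent_ineq R a c b" and R: "finite R" and fin: "finite (set_pmf p)"
    and h: "\<And>r. r \<in> R \<Longrightarrow> cent p (\<lambda>\<omega>. X \<omega> + r * Y \<omega>) w \<le> h"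
  shows "a * cent p Y w + c * cent p (\<lambda>\<omega>. (X \<omega>, Y \<omega>)) w \<le> b * h"
proof -
  have "finite (X ` set_pmf p \<union> Y ` set_pmf p)" using fin by simp
  then obtain d :: int where d: "d > 0" "\<forall>x \<in> X ` set_pmf p \<union> Y ` set_pmf p. of_int d * x \<in> \<int>"
    using ex_common_denominator by blast
  define Z where "Z = (\<lambda>\<omega>. (\<lfloor>of_int d * X \<omega>\<rfloor>, \<lfloor>of_int d * Y \<omega>\<rfloor>))"
  have Z: "rat_of_int (fst (Z \<omega>)) = of_int d * X \<omega>" "rat_of_int (snd (Z \<omega>)) = of_int d * Y \<omega>"
    if "\<omega> \<in> set_pmf p" for \<omega>
    using d(2) that by (auto simp: Z_def)
  have snd_eq: "snd (Z \<omega>) = snd (Z \<omega>') \<longleftrightarrow> Y \<omega> = Y \<omega>'"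
    and fst_eq: "fst (Z \<omega>) = fst (Z \<omega>') \<longleftrightarrow> X \<omega> = X \<omega>'"
    if "\<omega> \<in> set_pmf p" "\<omega>' \<in> set_pmf p" for \<omega> \<omega>'
    using Z[OF that(1)] Z[OF that(2)] d(1) by (metis mult_cancel_left of_int_eq_0_iff of_int_eq_iff less_irrefl)+
  have lin: "lin_comb r (Z \<omega>) = of_int d * (X \<omega> + r * Y \<omega>)" if "\<omega> \<in> set_pmf p" for r \<omega>
    using Z[OF that] by (simp add: algebra_simps)
  have 1: "cent p (\<lambda>\<omega>. lin_comb r (Z \<omega>)) w = cent p (\<lambda>\<omega>. X \<omega> + r * Y \<omega>) w" for r
    by (rule cent_eqI[OF fin]) (use d(1) in \<open>simp add: lin\<close>)
  have 2: "cent p (\<lambda>\<omega>. snd (Z \<omega>)) w = cent p Y w"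
    by (rule cent_eqI[OF fin]) (simp add: snd_eq)
  have 3: "cent p Z w = cent p (\<lambda>\<omega>. (X \<omega>, Y \<omega>)) w"
    by (rule cent_eqI[OF fin]) (simp add: prod_eq_iff snd_eq fst_eq)
  have "a * cent p (\<lambda>\<omega>. snd (Z \<omega>)) w + c * cent p Z w \<le> b * h"
    by (rule ent_ineq_cent_int[OF ineq R fin]) (simp only: 1 h)
  then show ?thesis unfolding 2 3 .
qed

text \<open>J collects the coordinates already removed; the induction closes only because the claim
  is conditional on them and h is free to change.\<close>

lemma cent_vector_le:
  fixes Y :: "nat \<Rightarrow> 'a \<Rightarrow> rat" and X :: "'a \<Rightarrow> rat" and b h :: real
  assumes ineq: "ent_ineq R 1 0 b" and R: "finite R" "R \<noteq> {}" and b: "b > 1" and fin: "finite (set_pmf p)"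
    and I: "finite I"
    and h: "\<And>r. r \<in> I \<rightarrow>\<^sub>E R \<Longrightarrow> cent p (\<lambda>\<omega>. X \<omega> + (\<Sum>i\<in>I. r i * Y i \<omega>)) (\<lambda>\<omega>. \<lambda>i\<in>J. Y i \<omega>) \<le> h"
  shows "(\<Sum>j<card I. ((b - 1) / b) ^ j) * cent p (\<lambda>\<omega>. \<lambda>i\<in>I. Y i \<omega>) (\<lambda>\<omega>. \<lambda>i\<in>J. Y i \<omega>) \<le> card I * (b * h)"
  using I h
proof (induction "card I" arbitrary: I J h)
  case 0
  then show ?case by simp
next
  case (Suc n)
  define c where "c = (b - 1) / b"
  have c: "0 \<le> c" "c \<le> 1" "c * b = b - 1" using b by (auto simp: c_def)
  define H where "H = cent p (\<lambda>\<omega>. \<lambda>i\<in>I. Y i \<omega>) (\<lambda>\<omega>. \<lambda>i\<in>J. Y i \<omega>)"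
  have cI: "card I = Suc n" using Suc by simp
  have "H \<le> (\<Sum>i\<in>I. cent p (Y i) (\<lambda>\<omega>. \<lambda>i\<in>J. Y i \<omega>))"
    unfolding H_def by (rule cent_restrict_le_sum[OF fin Suc.prems(1)])
  then obtain i where i: "i \<in> I" and Hi: "H / Suc n \<le> cent p (Y i) (\<lambda>\<omega>. \<lambda>i\<in>J. Y i \<omega>)"
    using sum_bounded_above_strict[of I "\<lambda>i. cent p (Y i) (\<lambda>\<omega>. \<lambda>i\<in>J. Y i \<omega>)" "H / Suc n"] cI
    by (force simp: not_le)
  define a where "a = cent p (Y i) (\<lambda>\<omega>. \<lambda>i\<in>J. Y i \<omega>)"
  have Ha: "H \<le> Suc n * a" using Hi by (simp add: a_def field_simps)
  \<comment> \<open>The bound that the improved inequality for coordinate i leaves for the remaining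
    ones, once Y i is conditioned on.\<close>
  define h' where "h' = (b * h - a) / (b - 1)"
  let ?I = "I - {i}" and ?J = "insert i J"
  have J_fib: "(\<lambda>j\<in>?J. Y j \<omega>) = (\<lambda>j\<in>?J. Y j \<omega>') \<longleftrightarrow> Y i \<omega> = Y i \<omega>' \<and> (\<lambda>j\<in>J. Y j \<omega>) = (\<lambda>j\<in>J. Y j \<omega>')" for \<omega> \<omega>'
    by (auto simp: fun_eq_iff restrict_def split: if_splits)
  have cond: "cent p f (\<lambda>\<omega>. \<lambda>j\<in>?J. Y j \<omega>) = cent p f (\<lambda>\<omega>. (Y i \<omega>, \<lambda>j\<in>J. Y j \<omega>))" for f :: "'a \<Rightarrow> 'b"
    by (rule antisym; rule cent_antimono[OF fin]; unfold J_fib prod.inject)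
  have h'_bound: "cent p (\<lambda>\<omega>. X \<omega> + (\<Sum>j\<in>?I. r j * Y j \<omega>)) (\<lambda>\<omega>. \<lambda>j\<in>?J. Y j \<omega>) \<le> h'"
    if r: "r \<in> ?I \<rightarrow>\<^sub>E R" for r
  proof -
    \<comment> \<open>Fix the coefficients off i and treat the partial sum as the X of a
      one-variable problem; letting s vary over R stays within the hypothesis because the
      coefficients form a full power of R.\<close>
    define X' where "X' = (\<lambda>\<omega>. X \<omega> + (\<Sum>j\<in>?I. r j * Y j \<omega>))"
    have "cent p (\<lambda>\<omega>. X' \<omega> + s * Y i \<omega>) (\<lambda>\<omega>. \<lambda>j\<in>J. Y j \<omega>) \<le> h" if s: "s \<in> R" for s
    proof -
      have mem: "r(i := s) \<in> I \<rightarrow>\<^sub>E R" using r s i by (auto simp: PiE_iff extensional_def)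
      have eq: "X' \<omega> + s * Y i \<omega> = X \<omega> + (\<Sum>j\<in>I. (r(i := s)) j * Y j \<omega>)" for \<omega>
      proof -
        have "(\<Sum>j\<in>?I. (r(i := s)) j * Y j \<omega>) = (\<Sum>j\<in>?I. r j * Y j \<omega>)"
          by (rule sum.cong) auto
        then show ?thesis using Suc.prems(1) i by (simp add: X'_def sum.remove)
      qed
      show ?thesis unfolding eq by (rule Suc.prems(2)[OF mem])
    qed
    then have "(2 - b) * a + (b - 1) * cent p (\<lambda>\<omega>. (X' \<omega>, Y i \<omega>)) (\<lambda>\<omega>. \<lambda>j\<in>J. Y j \<omega>) \<le> b * h"
      unfolding a_def using b by (intro ent_ineq_cent_rat[OF ent_ineq_joint[OF ineq R] R(1) fin]) auto
    then have "a + (b - 1) * cent p X' (\<lambda>\<omega>. (Y i \<omega>, \<lambda>j\<in>J. Y j \<omega>)) \<le> b * h"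
      unfolding cent_chain[OF fin] a_def[symmetric] by (simp add: algebra_simps)
    then show ?thesis using b unfolding cond X'_def[symmetric] by (simp add: h'_def field_simps)
  qed
  \<comment> \<open>The bound h' dominates a conditional entropy, so it is nonnegative, which means
    a <= b h. This settles the case of a single coordinate.\<close>
  obtain r where "r \<in> ?I \<rightarrow>\<^sub>E R" using R(2) by (metis PiE_eq_empty_iff all_not_in_conv)
  from order_trans[OF cent_nonneg[OF fin] h'_bound[OF this]]
  have abh: "a \<le> b * h" using b by (simp add: h'_def field_simps)
  have "cent p (\<lambda>\<omega>. \<lambda>j\<in>?I. Y j \<omega>) (\<lambda>\<omega>. \<lambda>j\<in>?J. Y j \<omega>) = H - a"
  proof -
    have "H = cent p (\<lambda>\<omega>. (\<lambda>j\<in>?I. Y j \<omega>, Y i \<omega>)) (\<lambda>\<omega>. \<lambda>j\<in>J. Y j \<omega>)"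
      unfolding H_def
    proof (rule cent_eqI[OF fin])
      show "(\<lambda>j\<in>I. Y j \<omega>) = (\<lambda>j\<in>I. Y j \<omega>') \<longleftrightarrow>
          (\<lambda>j\<in>?I. Y j \<omega>, Y i \<omega>) = (\<lambda>j\<in>?I. Y j \<omega>', Y i \<omega>')" for \<omega> \<omega>'
        using i by (auto simp: fun_eq_iff restrict_def split: if_splits)
    qed
    then show ?thesis unfolding cond by (simp add: cent_chain[OF fin] a_def)
  qed
  then have IH: "(\<Sum>j<n. c ^ j) * (H - a) \<le> n * (b * h')"
    using Suc.hyps(1)[of ?I ?J h'] h'_bound Suc.prems(1) i cI by (simp add: c_def)
  define T where "T = c * (\<Sum>j<n. c ^ j)"
  have h'_eq: "b * h' * c = b * h - a" using b by (simp add: h'_def c_def field_simps)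
  have IH': "T * (H - a) \<le> n * (b * h - a)"
  proof -
    have "T * (H - a) = c * ((\<Sum>j<n. c ^ j) * (H - a))" by (simp add: T_def)
    also have "\<dots> \<le> c * (n * (b * h'))" using IH c(1) by (rule mult_left_mono)
    also have "\<dots> = n * (b * h' * c)" by simp
    finally show ?thesis unfolding h'_eq .
  qed
  have T: "T \<le> n"
  proof -
    have "(\<Sum>j<n. c ^ j) \<le> (\<Sum>j<n. 1)" using c by (intro sum_mono power_le_one)
    then have "(\<Sum>j<n. c ^ j) \<le> n" by simp
    moreover have "0 \<le> (\<Sum>j<n. c ^ j)" using c by (intro sum_nonneg) auto
    ultimately show ?thesis unfolding T_def using mult_mono[OF c(2), of "\<Sum>j<n. c ^ j" n] by simp
  qed
  have "(1 + T) * H \<le> Suc n * (b * h)"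
  proof (cases "n = 0")
    case True
    then show ?thesis using Ha abh by (simp add: T_def)
  next
    case False
    \<comment> \<open>The weights n - T and n + 1 are chosen so that a cancels when the two
      inequalities are added, leaving n times the claim; T <= n keeps the first weight
      nonnegative.\<close>
    have "(n - T) * H \<le> (n - T) * (Suc n * a)" using T Ha by (intro mult_left_mono) auto
    moreover have "Suc n * (T * (H - a)) \<le> Suc n * (n * (b * h - a))"
      using IH' by (intro mult_left_mono) auto
    ultimately have "n * ((1 + T) * H) \<le> n * (Suc n * (b * h))" by (simp add: algebra_simps)
    then show ?thesis using False by simp
  qed
  also have "1 + T = (\<Sum>j<Suc n. c ^ j)"
    unfolding T_def sum.lessThan_Suc_shift by (simp add: sum_distrib_left)
  finally show ?case unfolding cI by (simp add: H_def c_def)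
qed

section \<open>Entropy of simple functions\<close>

text \<open>The values of V with probability zero are finitely many, so they form a null set, as the
  type of probability mass functions demands.\<close>

lemma ex_pmf_distr:
  assumes M: "prob_space M" and V: "simple_function M V"
  shows "\<exists>p. measure_pmf p = distr M (count_space UNIV) V"
proof -
  let ?N = "distr M (count_space UNIV) V"
  have Vm: "V \<in> M \<rightarrow>\<^sub>M count_space UNIV" using V by (rule measurable_simple_function)
  interpret N: prob_space ?N by (rule prob_space.prob_space_distr[OF M Vm])
  have fin: "finite (V ` space M)" using V by (rule simple_functionD)
  have N: "emeasure ?N A = emeasure M (V -` A \<inter> space M)" for A
    by (rule emeasure_distr[OF Vm]) simp
  have "{v. measure ?N {v} = 0} \<inter> V ` space M \<in> null_sets ?N"
  proof -
    have "(\<Union>v\<in>{v. measure ?N {v} = 0} \<inter> V ` space M. {v}) \<in> null_sets ?N"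
      using fin by (intro null_sets.finite_UN) (auto simp: null_sets_def N.emeasure_eq_measure)
    then show ?thesis by simp
  qed
  moreover have "- V ` space M \<in> null_sets ?N"
  proof -
    have "V -` (- V ` space M) \<inter> space M = {}" by auto
    then show ?thesis by (auto simp: null_sets_def N)
  qed
  ultimately have "({v. measure ?N {v} = 0} \<inter> V ` space M) \<union> - V ` space M \<in> null_sets ?N"
    by (rule null_sets.Un)
  then have "AE v in ?N. measure ?N {v} \<noteq> 0"
    by (rule AE_I') auto
  then have "?N \<in> {M. prob_space M \<and> sets M = UNIV \<and> (AE x in M. measure M {x} \<noteq> 0)}"
    using N.prob_space_axioms by simp
  then obtain p where "?N = measure_pmf p"
    by (rule measure_pmf_cases)
  then show ?thesis by metis
qed

lemma
  assumes M: "prob_space M" and V: "simple_function M V"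
    and p: "measure_pmf p = distr M (count_space UNIV) V"
  shows finite_set_pmf_distr: "finite (set_pmf p)"
    and shannon_entropy_eq_ent: "shannon_entropy M (\<lambda>\<omega>. G (V \<omega>)) = ent p G / ln 2"
proof -
  have Vm: "V \<in> M \<rightarrow>\<^sub>M count_space UNIV" using V by (rule measurable_simple_function)
  have finV: "finite (V ` space M)" using V by (rule simple_functionD)
  have m: "measure (measure_pmf p) A = measure M (V -` A \<inter> space M)" for A
    unfolding p by (rule measure_distr[OF Vm]) simp
  have sub: "set_pmf p \<subseteq> V ` space M"
  proof
    fix v assume "v \<in> set_pmf p"
    then have "measure (measure_pmf p) {v} \<noteq> 0" by (simp add: measure_pmf_single set_pmf_iff)
    then have "V -` {v} \<inter> space M \<noteq> {}" unfolding m by auto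
    then show "v \<in> V ` space M" by auto
  qed
  then show fin: "finite (set_pmf p)" using finV by (rule finite_subset)
  let ?m = "\<lambda>x. pmf (map_pmf G p) x"
  have mG: "measure M ((\<lambda>\<omega>. G (V \<omega>)) -` {x} \<inter> space M) = ?m x" for x
    unfolding pmf_map m by (intro arg_cong[where f="measure M"]) auto
  have "shannon_entropy M (\<lambda>\<omega>. G (V \<omega>)) = - (\<Sum>x\<in>G ` V ` space M. ?m x * log 2 (?m x))"
    unfolding mG[symmetric]
    by (rule shannon_entropy_eq_sum[OF M simple_function_compose1[OF V]]) (use finV in auto)
  also have "(\<Sum>x\<in>G ` V ` space M. ?m x * log 2 (?m x)) = (\<Sum>x\<in>G ` set_pmf p. ?m x * log 2 (?m x))"
  proof (rule sum.mono_neutral_right)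
    show "finite (G ` V ` space M)" using finV by simp
    show "G ` set_pmf p \<subseteq> G ` V ` space M" using sub by blast
    show "\<forall>x\<in>G ` V ` space M - G ` set_pmf p. ?m x * log 2 (?m x) = 0"
      by (simp add: pmf_map_outside)
  qed
  also have "- (\<Sum>x\<in>G ` set_pmf p. ?m x * log 2 (?m x)) = (\<Sum>x\<in>G ` set_pmf p. ?m x * - ln (?m x)) / ln 2"
    by (simp add: log_def sum_divide_distrib sum_negf)
  also have "(\<Sum>x\<in>G ` set_pmf p. ?m x * - ln (?m x)) = ent p G"
    unfolding ent_def by (rule sum_pmf_comp[OF fin, symmetric])
  finally show "shannon_entropy M (\<lambda>\<omega>. G (V \<omega>)) = ent p G / ln 2" .
qed

lemma simple_function_restrict:
  fixes Y :: "nat \<Rightarrow> 'a \<Rightarrow> 'b"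
  assumes "\<And>i. i < d \<Longrightarrow> simple_function M (Y i)"
  shows "simple_function M (\<lambda>\<omega>. \<lambda>i\<in>{..<d}. Y i \<omega>)"
  using assms
proof (induction d)
  case (Suc d)
  have "simple_function M (\<lambda>\<omega>. \<lambda>i\<in>{..<d}. Y i \<omega>)"
    by (rule Suc.IH, rule Suc.prems) simp
  moreover have "simple_function M (Y d)" by (rule Suc.prems) simp
  ultimately have "simple_function M (\<lambda>\<omega>. (\<lambda>i\<in>{..<d}. Y i \<omega>)(d := Y d \<omega>))"
    by (rule simple_function_compose2[where h="\<lambda>f y. f(d := y)"])
  moreover have "(\<lambda>\<omega>. (\<lambda>i\<in>{..<d}. Y i \<omega>)(d := Y d \<omega>)) = (\<lambda>\<omega>. \<lambda>i\<in>{..<Suc d}. Y i \<omega>)"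
    by (auto simp: fun_eq_iff restrict_def)
  ultimately show ?case by (simp only:)
qed (simp add: restrict_def)

abbreviation coords :: "nat \<Rightarrow> int \<times> (nat \<Rightarrow> int) \<Rightarrow> nat \<Rightarrow> int" where
  "coords d z \<equiv> \<lambda>i\<in>{..<d}. snd z i"

abbreviation comb_at :: "nat \<Rightarrow> (nat \<Rightarrow> rat) \<Rightarrow> int \<times> (nat \<Rightarrow> int) \<Rightarrow> rat" where
  "comb_at d r z \<equiv> of_int (fst z) + (\<Sum>i<d. r i * of_int (snd z i))"

lemma Max_divide:
  fixes f :: "'a \<Rightarrow> real"
  assumes "finite S" "S \<noteq> {}" "k > 0"
  shows "Max ((\<lambda>r. f r / k) ` S) = Max (f ` S) / k"
proof -
  have "mono (\<lambda>x. x / k)" using assms(3) by (intro monoI divide_right_mono) auto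
  from mono_Max_commute[OF this, of "f ` S"] show ?thesis using assms by (simp add: image_image)
qed

text \<open>Only the joint law of X and Y matters, so sample spaces give way to mass functions. Bits
  become nats on both sides, and the factor ln 2 cancels.\<close>

lemma entropy_bound_iff_ent:
  assumes S: "finite S" "S \<noteq> {}"
  shows "entropy_bound d S b \<longleftrightarrow>
    (\<forall>p\<in>{p. finite (set_pmf p)}. ent p (coords d) \<le> b * Max ((\<lambda>r. ent p (comb_at d r)) ` S))"
proof -
  have ln2: "0 < ln (2 :: real)" by simp
  show ?thesis
  proof safe
    fix p :: "(int \<times> (nat \<Rightarrow> int)) pmf"
    assume bound: "entropy_bound d S b" and fin: "finite (set_pmf p)"
    obtain z0 where z0: "z0 \<in> set_pmf p" using set_pmf_not_empty by fast
    \<comment> \<open>The identity almost surely, with points off the support sent to z0: a simple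
      function needs a finite range on the whole space.\<close>
    define V where "V = (\<lambda>z. if z \<in> set_pmf p then z else z0)"
    have V: "simple_function (measure_pmf p) V"
    proof -
      have "V ` UNIV \<subseteq> set_pmf p" using z0 by (auto simp: V_def)
      then have "finite (V ` UNIV)" using fin by (rule finite_subset)
      then show ?thesis by (simp add: simple_function_def)
    qed
    have distr: "measure_pmf p = distr (measure_pmf p) (count_space UNIV) V"
    proof -
      have "map_pmf V p = map_pmf (\<lambda>z. z) p" by (rule map_pmf_cong) (auto simp: V_def)
      then show ?thesis by (metis map_pmf_ident map_pmf_rep_eq)
    qed
    note E = shannon_entropy_eq_ent[OF prob_space_measure_pmf V distr]
    have "shannon_entropy (measure_pmf p) (\<lambda>\<omega>. coords d (V \<omega>))
        \<le> b * Max ((\<lambda>r. shannon_entropy (measure_pmf p) (\<lambda>\<omega>. comb_at d r (V \<omega>))) ` S)"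
      by (rule entropy_bound_any_space[OF bound prob_space_measure_pmf])
        (rule simple_function_compose1[OF V])+
    then show "ent p (coords d) \<le> b * Max ((\<lambda>r. ent p (comb_at d r)) ` S)"
      unfolding E[of "coords d"] E[of "comb_at d _"] Max_divide[OF S ln2]
      using ln2 by (simp add: field_simps)
  next
    assume *: "\<forall>p\<in>{p. finite (set_pmf p)}. ent p (coords d) \<le> b * Max ((\<lambda>r. ent p (comb_at d r)) ` S)"
    show "entropy_bound d S b"
      unfolding entropy_bound_def
    proof (intro allI impI)
      fix M :: "nat measure" and X :: "nat \<Rightarrow> int" and Y :: "nat \<Rightarrow> nat \<Rightarrow> int"
      assume M: "prob_space M" and X: "simple_function M X" and Y: "\<forall>i<d. simple_function M (Y i)"
      define V where "V = (\<lambda>\<omega>. (X \<omega>, \<lambda>i\<in>{..<d}. Y i \<omega>))"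
      have V: "simple_function M V"
        unfolding V_def using X Y by (intro simple_function_Pair simple_function_restrict) auto
      obtain p where p: "measure_pmf p = distr M (count_space UNIV) V"
        using ex_pmf_distr[OF M V] by blast
      note E = shannon_entropy_eq_ent[OF M V p]
      have 1: "(\<lambda>\<omega>. \<lambda>i\<in>{..<d}. Y i \<omega>) = (\<lambda>\<omega>. coords d (V \<omega>))"
        by (auto simp: V_def fun_eq_iff)
      have 2: "(\<lambda>\<omega>. of_int (X \<omega>) + (\<Sum>i<d. r i * of_int (Y i \<omega>))) = (\<lambda>\<omega>. comb_at d r (V \<omega>))" for r
        by (auto simp: V_def fun_eq_iff)
      have "ent p (coords d) \<le> b * Max ((\<lambda>r. ent p (comb_at d r)) ` S)"
        using * finite_set_pmf_distr[OF M V p] by blast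
      then show "shannon_entropy M (\<lambda>\<omega>. \<lambda>i\<in>{..<d}. Y i \<omega>)
          \<le> b * Max ((\<lambda>r. shannon_entropy M (\<lambda>\<omega>. of_int (X \<omega>) + (\<Sum>i<d. r i * of_int (Y i \<omega>)))) ` S)"
        unfolding 1 2 E[of "coords d"] E[of "comb_at d _"] Max_divide[OF S ln2]
        using ln2 by (simp add: field_simps)
    qed
  qed
qed

text \<open>\<open>LEAST\<close> over the reals is meaningful only if a minimum is attained. Each
  constraint is closed in b, and the one at j, with f j positive, excludes negative b, so the
  infimum is the minimum.\<close>

lemma Least_linear_bound:
  fixes f g :: "'i \<Rightarrow> real" and I :: "'i set"
  defines "P \<equiv> \<lambda>b. \<forall>i\<in>I. f i \<le> b * g i"
  assumes g: "\<And>i. i \<in> I \<Longrightarrow> 0 \<le> g i" and "P b0" and j: "j \<in> I" "0 < f j"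
  shows "P (LEAST b. P b)" and "\<And>b. P b \<Longrightarrow> (LEAST b. P b) \<le> b"
proof -
  define B where "B = Inf (Collect P)"
  have nonneg: "0 \<le> b" if "P b" for b
  proof (rule ccontr)
    assume "\<not> 0 \<le> b"
    then have "b * g j \<le> 0" using g[OF j(1)] by (simp add: mult_nonpos_nonneg)
    moreover have "f j \<le> b * g j" using that j(1) by (simp add: P_def)
    ultimately show False using j(2) by linarith
  qed
  have bdd: "bdd_below (Collect P)" using nonneg by (intro bdd_belowI[of _ 0]) auto
  have le: "B \<le> b" if "P b" for b
    unfolding B_def using that bdd by (intro cInf_lower) auto
  have "P B"
    unfolding P_def
  proof
    fix i assume i: "i \<in> I"
    have b0: "f i \<le> b0 * g i" using \<open>P b0\<close> i by (simp add: P_def)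
    show "f i \<le> B * g i"
    \<comment> \<open>If g i = 0 the constraint is independent of b and is inherited from
      b0.\<close>
    proof (cases "g i = 0")
      case True
      then show ?thesis using b0 by simp
    next
      case False
      then have gi: "0 < g i" using g[OF i] by simp
      have "f i / g i \<le> B"
        unfolding B_def
      proof (rule cInf_greatest)
        show "Collect P \<noteq> {}" using \<open>P b0\<close> by blast
        fix b assume "b \<in> Collect P"
        then show "f i / g i \<le> b" using i gi by (simp add: P_def field_simps)
      qed
      then show ?thesis using gi by (simp add: field_simps)
    qed
  qed
  then have "(LEAST b. P b) = B" using le by (rule Least_equality)
  then show "P (LEAST b. P b)" "\<And>b. P b \<Longrightarrow> (LEAST b. P b) \<le> b" using \<open>P B\<close> le by simp_all
qed

section \<open>Uniform distributions as tests of the constant\<close>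

lemma ent_pmf_of_set_inj:
  assumes Q: "finite Q" "Q \<noteq> {}" and f: "inj_on f Q"
  shows "ent (pmf_of_set Q) f = ln (card Q)"
proof -
  have "pmf (map_pmf f (pmf_of_set Q)) (f \<omega>) = 1 / card Q" if "\<omega> \<in> Q" for \<omega>
    using pmf_map_inj[of f "pmf_of_set Q" \<omega>] Q f that by simp
  moreover have "card Q > 0" using Q by (simp add: card_gt_0_iff)
  ultimately show ?thesis using Q by (simp add: ent_def ln_div)
qed

lemma ent_pmf_of_set_less:
  assumes Q: "finite Q" "Q \<noteq> {}" and f: "\<not> inj_on f Q"
  shows "ent (pmf_of_set Q) f < ln (card Q)"
proof -
  have "ent (pmf_of_set Q) f \<le> ln (card (f ` Q))"
    using Q by (intro ent_le_ln_card) auto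
  also have "card (f ` Q) < card Q"
    using card_image_le[OF Q(1), of f] eq_card_imp_inj_on[OF Q(1), of f] f by linarith
  then have "ln (card (f ` Q)) < ln (card Q)"
    using Q by (subst ln_less_cancel_iff) (auto simp: card_gt_0_iff)
  finally show ?thesis .
qed

text \<open>Under the uniform law on Q, Y has the full entropy ln (card Q) while every X + rY has
  strictly less; this forces the constant above 1.\<close>

lemma ex_colliding_set:
  assumes "finite R"
  shows "\<exists>Q :: (int \<times> int) set. finite Q \<and> inj_on snd Q \<and> (\<forall>r\<in>R. \<not> inj_on (lin_comb r) Q)"
  using assms
proof induction
  case empty
  show ?case by (rule exI[of _ "{}"]) simp
next
  case (insert r R)
  then obtain Q :: "(int \<times> int) set" where Q: "finite Q" "inj_on snd Q" "\<forall>r\<in>R. \<not> inj_on (lin_comb r) Q"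
    by blast
  obtain e d where ed: "quotient_of r = (e, d)" by fastforce
  have d: "d > 0" "r = of_int e / of_int d"
    using quotient_of_denom_pos[OF ed] quotient_of_div[OF ed] by auto
  define y where "y = Max (insert 0 (snd ` Q)) + 1"
  have y: "snd z < y" if "z \<in> Q" for z
  proof -
    have "snd z \<le> Max (insert 0 (snd ` Q))" using Q that by (intro Max_ge) auto
    then show ?thesis by (simp add: y_def)
  qed
  \<comment> \<open>With r = e/d the two new points have the same value of X + rY; their second
    components lie above all old ones and differ by d > 0.\<close>
  define Q' where "Q' = insert (0, y) (insert (- e, y + d) Q)"
  have "inj_on snd Q'"
    unfolding Q'_def using Q(2) y d(1) by (auto simp: inj_on_insert) (use y d(1) in force)+
  moreover have "\<not> inj_on (lin_comb r) Q'"
  proof -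
    have "lin_comb r (0, y) = lin_comb r (- e, y + d)" using d by (simp add: field_simps)
    moreover have "(0, y) \<noteq> (- e, y + d)" using d by simp
    ultimately show ?thesis unfolding inj_on_def Q'_def by blast
  qed
  moreover have "\<not> inj_on (lin_comb s) Q'" if "s \<in> R" for s
    using Q(3) that inj_on_subset[of "lin_comb s" Q' Q] by (auto simp: Q'_def)
  ultimately show ?case using Q(1) by (intro exI[of _ Q']) (auto simp: Q'_def)
qed

section \<open>Optimal constants\<close>

text \<open>Ties pairs of integers to the case d = 1 of the vector setting, where only the entry at
  index 0 of the constant vector is read.\<close>

lemma
  fixes q :: "(int \<times> int) pmf"
  assumes fin: "finite (set_pmf q)"
  defines "p \<equiv> map_pmf (\<lambda>z. (fst z, \<lambda>_ :: nat. snd z)) q"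
  shows ent_coords_1: "ent p (coords 1) = ent q snd"
    and ent_comb_at_1: "ent p (comb_at 1 r) = ent q (lin_comb (r 0))"
proof -
  show "ent p (coords 1) = ent q snd"
    unfolding p_def ent_map_pmf[OF fin]
    by (rule ent_eqI[OF fin]) (auto simp: fun_eq_iff restrict_def)
  show "ent p (comb_at 1 r) = ent q (lin_comb (r 0))"
    unfolding p_def ent_map_pmf[OF fin] by simp
qed

lemma
  assumes "finite R" "R \<noteq> {}"
  shows finite_cart_power: "finite (cart_power R d)" and cart_power_nonempty: "cart_power R d \<noteq> {}"
  using assms by (auto intro!: finite_PiE simp: PiE_eq_empty_iff)

lemma ent_ineq_of_entropy_bound:
  assumes R: "finite R" "R \<noteq> {}" and b: "0 \<le> b" and bound: "entropy_bound 1 (cart_power R 1) b"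
  shows "ent_ineq R 1 0 b"
  unfolding ent_ineq_def
proof (intro allI impI)
  fix q :: "(int \<times> int) pmf" and h :: real
  assume fin: "finite (set_pmf q)" and h: "\<forall>r\<in>R. ent q (lin_comb r) \<le> h"
  define p where "p = map_pmf (\<lambda>z. (fst z, \<lambda>_ :: nat. snd z)) q"
  note S = finite_cart_power[OF R, of 1] cart_power_nonempty[OF R, of 1]
  have "ent q snd = ent p (coords 1)" using ent_coords_1[OF fin] by (simp add: p_def)
  also have "\<dots> \<le> b * Max ((\<lambda>r. ent p (comb_at 1 r)) ` cart_power R 1)"
    by (rule bound[unfolded entropy_bound_iff_ent[OF S], THEN bspec]) (simp add: p_def fin)
  also have "\<dots> \<le> b * h"
  proof (intro mult_left_mono b Max.boundedI)
    fix x assume "x \<in> (\<lambda>r. ent p (comb_at 1 r)) ` cart_power R 1"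
    then obtain r where r: "r \<in> cart_power R 1" and x: "x = ent p (comb_at 1 r)" by blast
    have "r 0 \<in> R" using r by auto
    then show "x \<le> h" using h ent_comb_at_1[OF fin, of r] by (simp add: x p_def)
  qed (use S in auto)
  finally show "1 * ent q snd + 0 * ent q (\<lambda>z. z) \<le> b * h" by simp
qed

text \<open>Makes b/(b - 1) meaningful and positive. Strictness comes from a single distribution on
  which all of the finitely many linear combinations lose entropy.\<close>

lemma entropy_bound_1_gt_1:
  assumes R: "finite R" "R \<noteq> {}" and bound: "entropy_bound 1 (cart_power R 1) b"
  shows "1 < b"
proof -
  obtain Q :: "(int \<times> int) set" where Q: "finite Q" "inj_on snd Q" and coll: "\<forall>r\<in>R. \<not> inj_on (lin_comb r) Q"
    using ex_colliding_set[OF R(1)] by blast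
  then have ne: "Q \<noteq> {}" using R(2) by auto
  define q where "q = pmf_of_set Q"
  have fin: "finite (set_pmf q)" using Q ne by (simp add: q_def)
  define p where "p = map_pmf (\<lambda>z. (fst z, \<lambda>_ :: nat. snd z)) q"
  note S = finite_cart_power[OF R, of 1] cart_power_nonempty[OF R, of 1]
  define m where "m = Max ((\<lambda>r. ent p (comb_at 1 r)) ` cart_power R 1)"
  have "ent p (coords 1) \<le> b * m"
    unfolding m_def
    by (rule bound[unfolded entropy_bound_iff_ent[OF S], THEN bspec]) (simp add: p_def fin)
  then have "ln (card Q) \<le> b * m"
    using ent_coords_1[OF fin] ent_pmf_of_set_inj[OF Q(1) ne Q(2)] by (simp add: p_def q_def)
  moreover have m: "m \<in> (\<lambda>r. ent p (comb_at 1 r)) ` cart_power R 1"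
    unfolding m_def using S by (intro Max_in) auto
  moreover have "0 \<le> m" using m ent_nonneg by blast
  moreover have "m < ln (card Q)"
  proof -
    obtain r where r: "r \<in> cart_power R 1" and "m = ent p (comb_at 1 r)" using m by blast
    then have "m = ent q (lin_comb (r 0))" using ent_comb_at_1[OF fin] by (simp add: p_def)
    moreover have "r 0 \<in> R" using r by auto
    then have "ent q (lin_comb (r 0)) < ln (card Q)"
      unfolding q_def by (intro ent_pmf_of_set_less[OF Q(1) ne] bspec[OF coll])
    ultimately show ?thesis by simp
  qed
  ultimately have "m < b * m" by linarith
  then have "0 < (b - 1) * m" by (simp add: algebra_simps)
  with \<open>0 \<le> m\<close> show ?thesis by (simp add: zero_less_mult_iff)
qed

text \<open>For r and s distinct, X + rY and X + sY determine Y, so H(Y) is at most the sum of their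
  entropies. This shows that some constant is admissible, and is where two elements of R are
  needed.\<close>

lemma entropy_bound_1_two:
  assumes R: "finite R" "card R \<ge> 2"
  shows "entropy_bound 1 (cart_power R 1) 2"
proof -
  have ne: "R \<noteq> {}" using R by auto
  note S = finite_cart_power[OF R(1) ne, of 1] cart_power_nonempty[OF R(1) ne, of 1]
  obtain r s where rs: "r \<in> R" "s \<in> R" "r \<noteq> s"
    using R by (metis card_2_iff' ex_card subset_iff)
  define f where "f = (\<lambda>t :: rat. \<lambda>i\<in>{..<1 :: nat}. t)"
  show ?thesis
    unfolding entropy_bound_iff_ent[OF S]
  proof safe
    fix p :: "(int \<times> (nat \<Rightarrow> int)) pmf"
    assume fin: "finite (set_pmf p)"
    let ?M = "Max ((\<lambda>r. ent p (comb_at 1 r)) ` cart_power R 1)"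
    have le: "ent p (comb_at 1 (f t)) \<le> ?M" if "t \<in> R" for t
    proof (rule Max_ge)
      show "ent p (comb_at 1 (f t)) \<in> (\<lambda>r. ent p (comb_at 1 r)) ` cart_power R 1"
        by (rule image_eqI[of _ _ "f t"]) (use that in \<open>auto simp: f_def\<close>)
    qed (use S in simp)
    have "ent p (coords 1) \<le> ent p (\<lambda>z. (comb_at 1 (f r) z, comb_at 1 (f s) z))"
    proof (rule ent_mono[OF fin])
      fix z z' :: "int \<times> (nat \<Rightarrow> int)"
      assume "(comb_at 1 (f r) z, comb_at 1 (f s) z) = (comb_at 1 (f r) z', comb_at 1 (f s) z')"
      then have "rat_of_int (fst z) + r * of_int (snd z 0) = of_int (fst z') + r * of_int (snd z' 0)"
        "rat_of_int (fst z) + s * of_int (snd z 0) = of_int (fst z') + s * of_int (snd z' 0)"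
        by (simp_all add: f_def)
      then have "(r - s) * (of_int (snd z 0) - of_int (snd z' 0)) = 0" by (simp add: algebra_simps)
      then have "snd z 0 = snd z' 0" using rs by simp
      then show "coords 1 z = coords 1 z'" by (auto simp: fun_eq_iff restrict_def)
    qed
    also have "\<dots> \<le> ent p (comb_at 1 (f r)) + ent p (comb_at 1 (f s))" by (rule ent_pair_le[OF fin])
    also have "\<dots> \<le> 2 * ?M" using le[OF rs(1)] le[OF rs(2)] by linarith
    finally show "ent p (coords 1) \<le> 2 * ?M" .
  qed
qed

lemma
  assumes S: "finite S" "S \<noteq> {}" and d: "d \<ge> 1" and b0: "entropy_bound d S b0"
  shows entropy_bound_beta: "entropy_bound d S (beta d S)"
    and beta_le: "entropy_bound d S b \<Longrightarrow> beta d S \<le> b"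
proof -
  let ?f = "\<lambda>p. ent p (coords d)" and ?g = "\<lambda>p. Max ((\<lambda>r. ent p (comb_at d r)) ` S)"
  let ?I = "{p :: (int \<times> (nat \<Rightarrow> int)) pmf. finite (set_pmf p)}"
  have g: "0 \<le> ?g p" for p
  proof -
    have "?g p \<in> (\<lambda>r. ent p (comb_at d r)) ` S" using S by (intro Max_in) auto
    then show ?thesis using ent_nonneg by fastforce
  qed
  \<comment> \<open>Y is a fair bit repeated in all coordinates, of entropy ln 2; d >= 1 makes it
    visible to \<open>coords d\<close>. Its positive entropy is what
    \<open>Least_linear_bound\<close> asks for.\<close>
  define Q :: "(int \<times> (nat \<Rightarrow> int)) set" where "Q = {(0, \<lambda>_. 0), (0, \<lambda>_. 1)}"
  have neq: "(\<lambda>_ :: nat. 0 :: int) \<noteq> (\<lambda>_. 1)" "(\<lambda>i\<in>{..<d}. 0 :: int) \<noteq> (\<lambda>i\<in>{..<d}. 1)"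
    using d by (auto dest: fun_cong[of _ _ 0])
  have Q: "finite Q" "Q \<noteq> {}" by (simp_all add: Q_def)
  have "card Q = 2" using neq(1) by (simp add: Q_def)
  moreover have "inj_on (coords d) Q" using neq by (auto simp: Q_def)
  ultimately have "?f (pmf_of_set Q) = ln 2" using ent_pmf_of_set_inj[OF Q, of "coords d"] by simp
  then have j: "0 < ?f (pmf_of_set Q)" "pmf_of_set Q \<in> ?I" using Q by simp_all
  note L = Least_linear_bound[of ?I ?g ?f b0 "pmf_of_set Q", OF g b0[unfolded entropy_bound_iff_ent[OF S]] j(2,1)]
  show "entropy_bound d S (beta d S)"
    unfolding beta_def entropy_bound_iff_ent[OF S] by (rule L(1))
  show "beta d S \<le> b" if "entropy_bound d S b"
    using that unfolding beta_def entropy_bound_iff_ent[OF S] by (rule L(2))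
qed

text \<open>With nothing conditioned on, the geometric sum is b (1 - c^d) because 1 - c = 1/b, so b
  cancels. The constant d / (1 - c^d) is the stated one, since 1/c = b/(b - 1).\<close>

lemma entropy_bound_cart_power:
  assumes R: "finite R" "R \<noteq> {}" and ineq: "ent_ineq R 1 0 b" and b: "b > 1" and d: "d \<ge> 1"
  shows "entropy_bound d (cart_power R d) (d * ((b / (b - 1)) ^ d / ((b / (b - 1)) ^ d - 1)))"
  unfolding entropy_bound_iff_ent[OF finite_cart_power[OF R] cart_power_nonempty[OF R]]
proof safe
  fix p :: "(int \<times> (nat \<Rightarrow> int)) pmf"
  assume fin: "finite (set_pmf p)"
  define m where "m = Max ((\<lambda>r. ent p (comb_at d r)) ` cart_power R d)"
  define Y where "Y = (\<lambda>i (z :: int \<times> (nat \<Rightarrow> int)). rat_of_int (snd z i))"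
  have cent: "cent p f (\<lambda>z. \<lambda>i\<in>{}. Y i z) = ent p f" for f :: "int \<times> (nat \<Rightarrow> int) \<Rightarrow> 'z"
    using ent_eqI[OF fin, of "\<lambda>z. (f z, \<lambda>i\<in>{}. Y i z)" f] by (simp add: cent_def restrict_def)
  have "(\<Sum>j<card {..<d}. ((b - 1) / b) ^ j) * cent p (\<lambda>z. \<lambda>i\<in>{..<d}. Y i z) (\<lambda>z. \<lambda>i\<in>{}. Y i z)
      \<le> card {..<d} * (b * m)"
  proof (rule cent_vector_le[OF ineq R b fin])
    fix r assume r: "r \<in> {..<d} \<rightarrow>\<^sub>E R"
    show "cent p (\<lambda>z. rat_of_int (fst z) + (\<Sum>i<d. r i * Y i z)) (\<lambda>z. \<lambda>i\<in>{}. Y i z) \<le> m"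
      unfolding cent m_def
    proof (rule Max_ge)
      show "ent p (\<lambda>z. rat_of_int (fst z) + (\<Sum>i<d. r i * Y i z)) \<in> (\<lambda>r. ent p (comb_at d r)) ` cart_power R d"
        by (rule image_eqI[OF _ r]) (simp add: Y_def)
    qed (use finite_cart_power[OF R] in simp)
  qed simp
  moreover have "ent p (\<lambda>z. \<lambda>i\<in>{..<d}. Y i z) = ent p (coords d)"
    by (rule ent_eqI[OF fin]) (auto simp: Y_def fun_eq_iff restrict_def)
  ultimately have le: "(\<Sum>j<d. ((b - 1) / b) ^ j) * ent p (coords d) \<le> d * (b * m)"
    unfolding cent by simp
  define c where "c = (b - 1) / b"
  have c: "0 < c" "c < 1" "1 - c = 1 / b" using b by (auto simp: c_def field_simps)
  have cd: "c ^ d < 1" using c d by (simp add: power_less_one_iff)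
  have "(\<Sum>j<d. c ^ j) = b * (1 - c ^ d)"
    using one_diff_power_eq[of c d] b by (simp add: c(3))
  then have "b * ((1 - c ^ d) * ent p (coords d)) \<le> b * (d * m)"
    using le by (simp add: c_def mult_ac)
  then have "(1 - c ^ d) * ent p (coords d) \<le> d * m" using b by simp
  then have "ent p (coords d) \<le> d / (1 - c ^ d) * m" using cd by (simp add: field_simps)
  also have "d / (1 - c ^ d) = d * ((b / (b - 1)) ^ d / ((b / (b - 1)) ^ d - 1))"
  proof -
    have q: "b / (b - 1) = 1 / c" by (simp add: c_def)
    have "c ^ d \<noteq> 0" using c by simp
    then show ?thesis unfolding q power_one_over using cd by (simp add: field_simps)
  qed
  finally show "ent p (coords d) \<le> d * ((b / (b - 1)) ^ d / ((b / (b - 1)) ^ d - 1))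
      * Max ((\<lambda>r. ent p (comb_at d r)) ` cart_power R d)"
    unfolding m_def .
qed

theorem theorem1p2:
  fixes R :: "rat set" and d :: nat and \<beta> :: real
  assumes "finite R" and "card R \<ge> 2"
    and "\<beta> = beta 1 (cart_power R 1)"
    and "d \<ge> 2"
  shows "beta d (cart_power R d)
    \<le> real d * ((\<beta> / (\<beta> - 1)) ^ d / ((\<beta> / (\<beta> - 1)) ^ d - 1))"
proof -
  have R: "finite R" "R \<noteq> {}" using assms by auto
  have "entropy_bound 1 (cart_power R 1) \<beta>"
    unfolding assms(3)
    by (rule entropy_bound_beta[OF finite_cart_power[OF R] cart_power_nonempty[OF R] _ entropy_bound_1_two])
      (use assms in auto)
  moreover from this have \<beta>: "1 < \<beta>" by (rule entropy_bound_1_gt_1[OF R])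
  ultimately have "ent_ineq R 1 0 \<beta>" by (intro ent_ineq_of_entropy_bound[OF R]) auto
  from entropy_bound_cart_power[OF R this \<beta>, of d] assms(4)
  have "entropy_bound d (cart_power R d) (d * ((\<beta> / (\<beta> - 1)) ^ d / ((\<beta> / (\<beta> - 1)) ^ d - 1)))" by simp
  \<comment> \<open>The same bound is used twice: to show that an admissible constant exists, and as
    the constant that the least one does not exceed.\<close>
  from beta_le[OF finite_cart_power[OF R] cart_power_nonempty[OF R] _ this this] assms(4)
  show ?thesis by simp
qed

end
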